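(* Fix an integer $k\ge 2$ and let $B_r$ be as in the context. Let $J\ge 0$, $i\in\{1,\dots,k\}$ and $r=(k-1)J+i$. Then $B_r=\sum_{n\ge0}b_{k,r}(n)q^n$, where $b_{k,r}(n)$ is the number of partitions $\pi=(\pi_1,\dots,\pi_{\ell(\pi)})$ of $n$ such that: (1) $\pi_t-\pi_{t+k-1}\ge 2$ for all $t$ with $t+k-1\le\ell(\pi)$; (2) $\pi_{\ell(\pi)}\ge J+1$; (3) $m_{J+1}(\pi)\le k-i$; (4) for all $t$ with $t+k-2\le\ell(\pi)$, $\pi_t-\pi_{t+k-2}\le 1$ only if $\pi_t+\pi_{t+1}+\cdots+\pi_{t+k-2}\equiv r+k\pmod 2$.
   Context: $q$ is a formal variable and all series lie in $\mathbb{C}((q))$. Write $(q)_\infty=\prod_{s\ge1}(1-q^s)$. Fix $k\ge 2$. For $i\in\{1,\dots,k\}$ set $B_i=\prod_{m\ge 1}(1-q^{2km})(1-q^{2km-k+i-1})(1-q^{2km-k-i+1})/(q)_\infty$. Recursively, for each $j\ge 0$, given $B_{(k-1)j+1},\dots,B_{(k-1)j+k}$, define ghost series $\tilde{B}_{(k-1)j+i}=(B_{(k-1)j+i-1}+q^{j+1}B_{(k-1)j+i+1})/(1+q^{j+1})$ for $i\in\{2,\dots,k-1\}$ and $\tilde{B}_{(k-1)j+k}=B_{(k-1)j+k-1}/(1+q^{j+1})$; then $B_{(k-1)(j+1)+1}$ is the already defined $B_{(k-1)j+k}$, $B_{(k-1)(j+1)+2}=(B_{(k-1)j+k-1}-\tilde{B}_{(k-1)j+k})/q^{j+1}$,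 and $B_{(k-1)(j+1)+i}=(B_{(k-1)j+k-i+1}-\tilde{B}_{(k-1)j+k-i+2})/q^{(j+1)(i-1)}$ for $i\in\{3,\dots,k\}$. A partition of $n$ is a nonincreasing finite sequence $\pi_1\ge\cdots\ge\pi_{\ell(\pi)}$ of positive integers summing to $n$ (the empty partition counts for $n=0$); $m_p(\pi)$ is the number of parts equal to $p$. *)

theory Defs
  imports
    "HOL-Analysis.Analysis"
    "HOL-Computational_Algebra.Formal_Laurent_Series"
    "HOL-Number_Theory.Cong"
begin

text \<open>Infinite products are taken in the \<open>q\<close>-adic metric on formal Laurent series.\<close>

abbreviation q :: "complex fls" where
  "q \<equiv> fls_X"

definition qpoch_inf :: "complex fls" where
  "qpoch_inf = (\<Prod>s. 1 - q ^ Suc s)"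

text \<open>The product index is shifted, \<open>m = Suc m'\<close>.  For \<open>1 \<le> i \<le> k\<close> none of the
  subtractions in the exponents is truncated.\<close>

definition B_init :: "nat \<Rightarrow> nat \<Rightarrow> complex fls" where
  "B_init k i =
     (\<Prod>m'. let m = Suc m' in
        (1 - q ^ (2 * k * m)) * (1 - q ^ (2 * k * m - k + i - 1)) * (1 - q ^ (2 * k * m - k - i + 1)))
     / qpoch_inf"

text \<open>\<open>B_block k j i\<close>, for \<open>1 \<le> i \<le> k\<close>, is the series with index \<open>(k - 1) * j + i\<close>; consecutive
  blocks overlap in one index.  \<open>ghost k j b i\<close>, for \<open>2 \<le> i \<le> k\<close>, is the ghost series with index
  \<open>(k - 1) * j + i\<close>, computed from the \<open>j\<close>-th block \<open>b\<close>.  Values for other \<open>i\<close> are irrelevant.\<close>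

definition ghost :: "nat \<Rightarrow> nat \<Rightarrow> (nat \<Rightarrow> complex fls) \<Rightarrow> nat \<Rightarrow> complex fls" where
  "ghost k j b i =
     (if i = k then b (k - 1) / (1 + q ^ (j + 1))
      else (b (i - 1) + q ^ (j + 1) * b (i + 1)) / (1 + q ^ (j + 1)))"

primrec B_block :: "nat \<Rightarrow> nat \<Rightarrow> nat \<Rightarrow> complex fls" where
  "B_block k 0 = B_init k"
| "B_block k (Suc j) =
     (\<lambda>i. let b = B_block k j in
        if i = 1 then b k
        else if i = 2 then (b (k - 1) - ghost k j b k) / q ^ (j + 1)
        else (b (k - i + 1) - ghost k j b (k - i + 2)) / q ^ ((j + 1) * (i - 1)))"

text \<open>Every \<open>r \<ge> 1\<close> is uniquely \<open>(k - 1) * j + i\<close> with \<open>1 \<le> i \<le> k - 1\<close>, and every \<open>r \<ge> 2\<close> is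
  uniquely \<open>(k - 1) * j + i\<close> with \<open>2 \<le> i \<le> k\<close>.\<close>

definition B :: "nat \<Rightarrow> nat \<Rightarrow> complex fls" where
  "B k r = B_block k ((r - 1) div (k - 1)) ((r - 1) mod (k - 1) + 1)"

definition B_ghost :: "nat \<Rightarrow> nat \<Rightarrow> complex fls" where
  "B_ghost k r =
     (let j = (r - 2) div (k - 1); i = (r - 2) mod (k - 1) + 2 in ghost k j (B_block k j) i)"

lemma B_eq_block:
  assumes "k \<ge> 2" "1 \<le> i" "i \<le> k"
  shows "B k ((k - 1) * j + i) = B_block k j i"
proof (cases "i = k")
  case True
  then have "(k - 1) * j + i - 1 = (k - 1) * Suc j"
    using assms by simp
  then have "((k - 1) * j + i - 1) div (k - 1) = Suc j" "((k - 1) * j + i - 1) mod (k - 1) = 0"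
    using assms by (simp_all only: nonzero_mult_div_cancel_left mod_mult_self1_is_0)
  then have "B k ((k - 1) * j + i) = B_block k (Suc j) 1"
    unfolding B_def by (simp only: add_0)
  then show ?thesis
    using True by simp
next
  case False
  then have "(k - 1) * j + i - 1 = (i - 1) + (k - 1) * j" "i - 1 < k - 1"
    using assms by auto
  then have "((k - 1) * j + i - 1) div (k - 1) = j" "((k - 1) * j + i - 1) mod (k - 1) = i - 1"
    by simp_all
  then show ?thesis
    using assms unfolding B_def by simp
qed

lemma B_ghost_eq_ghost:
  assumes "2 \<le> i" "i \<le> k"
  shows "B_ghost k ((k - 1) * j + i) = ghost k j (B_block k j) i"
proof -
  have "(k - 1) * j + i - 2 = (i - 2) + (k - 1) * j" "i - 2 < k - 1"
    using assms by auto
  then have "((k - 1) * j + i - 2) div (k - 1) = j" "((k - 1) * j + i - 2) mod (k - 1) = i - 2"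
    by simp_all
  moreover have "i - 2 + 2 = i"
    using assms by simp
  ultimately show ?thesis
    unfolding B_ghost_def Let_def by (simp only:)
qed

text \<open>The defining recursion, indexed by \<open>r\<close>.\<close>

lemma B_initial:
  assumes "k \<ge> 2" "1 \<le> i" "i \<le> k"
  shows "B k i = B_init k i"
  using B_eq_block[OF assms, of 0] by simp

lemma B_ghost_inner:
  assumes "2 \<le> i" "i \<le> k - 1"
  shows "B_ghost k ((k - 1) * j + i) =
    (B k ((k - 1) * j + i - 1) + q ^ (j + 1) * B k ((k - 1) * j + i + 1)) / (1 + q ^ (j + 1))"
  using assms B_ghost_eq_ghost[of i k j] B_eq_block[of k "i - 1" j] B_eq_block[of k "i + 1" j]
  by (simp add: ghost_def)

lemma B_ghost_last:
  assumes "k \<ge> 2"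
  shows "B_ghost k ((k - 1) * j + k) = B k ((k - 1) * j + k - 1) / (1 + q ^ (j + 1))"
  using assms B_ghost_eq_ghost[of k k j] B_eq_block[of k "k - 1" j]
  by (simp add: ghost_def)

lemma B_step_2:
  assumes "k \<ge> 2"
  shows "B k ((k - 1) * (j + 1) + 2) =
    (B k ((k - 1) * j + k - 1) - B_ghost k ((k - 1) * j + k)) / q ^ (j + 1)"
  using assms B_eq_block[of k 2 "Suc j"] B_eq_block[of k "k - 1" j] B_ghost_eq_ghost[of k k j]
  by (simp add: Let_def)

lemma B_step:
  assumes "3 \<le> i" "i \<le> k"
  shows "B k ((k - 1) * (j + 1) + i) =
    (B k ((k - 1) * j + k - i + 1) - B_ghost k ((k - 1) * j + k - i + 2)) / q ^ ((j + 1) * (i - 1))"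
  using assms B_eq_block[of k i "Suc j"] B_eq_block[of k "k - i + 1" j]
    B_ghost_eq_ghost[of "k - i + 2" k j]
  by (simp add: Let_def)

definition is_partition :: "nat \<Rightarrow> nat list \<Rightarrow> bool" where
  "is_partition n \<pi> \<longleftrightarrow> sorted_wrt (\<ge>) \<pi> \<and> (\<forall>p\<in>set \<pi>. p > 0) \<and> sum_list \<pi> = n"

text \<open>Parts are numbered from 1.\<close>

abbreviation part :: "nat list \<Rightarrow> nat \<Rightarrow> nat" where
  "part \<pi> t \<equiv> \<pi> ! (t - 1)"

text \<open>The indices \<open>t\<close> and \<open>t + k - 1\<close>, \<open>t + k - 2\<close> below satisfy \<open>t \<ge> 1\<close> and \<open>k \<ge> 2\<close>, and the
  parts are nonincreasing, so no subtraction is truncated.  The lower bound on the smallest part is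
  vacuous for the empty partition.\<close>

definition restricted_partitions :: "nat \<Rightarrow> nat \<Rightarrow> nat \<Rightarrow> nat \<Rightarrow> nat list set" where
  "restricted_partitions k J i n = {\<pi>. is_partition n \<pi> \<and>
     (\<forall>t\<ge>1. t + k - 1 \<le> length \<pi> \<longrightarrow> part \<pi> t - part \<pi> (t + k - 1) \<ge> 2) \<and>
     (\<pi> \<noteq> [] \<longrightarrow> part \<pi> (length \<pi>) \<ge> J + 1) \<and>
     count_list \<pi> (J + 1) \<le> k - i \<and>
     (\<forall>t\<ge>1. t + k - 2 \<le> length \<pi> \<longrightarrow> part \<pi> t - part \<pi> (t + k - 2) \<le> 1 \<longrightarrow>
        [(\<Sum>s = t..t + k - 2. part \<pi> s) = (k - 1) * J + i + k] (mod 2))}"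

lemma finite_restricted_partitions: "finite (restricted_partitions k J i n)"
proof (rule finite_subset)
  have "length \<pi> \<le> sum_list \<pi>" if "\<forall>p\<in>set \<pi>. p > 0" for \<pi> :: "nat list"
    using that by (induction \<pi>) auto
  then show "restricted_partitions k J i n \<subseteq> {\<pi>. set \<pi> \<subseteq> {..n} \<and> length \<pi> \<le> n}"
    by (auto simp: restricted_partitions_def is_partition_def member_le_sum_list)
  show "finite {\<pi>. set \<pi> \<subseteq> {..n} \<and> length \<pi> \<le> n}"
    by (rule finite_lists_length_le) simp
qed

end

(* Let C(u, J) be the generating function of the admissible partitions with all parts > J and fewer
   than u = k - i + 1 parts equal to J + 1. Removing the parts equal to J + 1 gives, with Q = q^(J+1),
     C(u, J) - C(u - 2, J) = Q^(u-2) (1 + Q) C(k + 1 - u, J + 1),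
   since the difference counts the partitions with u - 1 or u - 2 such parts, and the parity condition
   imposes the same bound on the number of parts J + 2 in both cases. This is the recursion of the
   ghost series, so only J = 0 remains. The recursion, read from J + 1 down to J, has at most one
   solution tending to 1 as J grows; an explicit alternating sum with q^2-binomial coefficients is
   such a solution, and for J = 0 the Jacobi triple product turns it into the product defining B_i.
   All limits are replaced by congruences modulo q^M. *)
theory Submission
  imports Defs
begin

section \<open>Congruences modulo powers of the indeterminate\<close>

text \<open>The step in \<open>u\<close> is two because raising \<open>u\<close> by one flips the
  parity demanded by condition (4): neighbouring classes are not nested, while classes two apart
  are. A chain in \<open>u\<close> therefore ends at \<open>u = 0\<close>, where the series
  vanishes, or at \<open>u = 1\<close>, where it is a series of the next level. A ghost series is
  the mean of C(u, J) and C(u - 2, J) with weights 1 and Q, hence the factor 1 + Q.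

  The recursion that defines the blocks climbs in J and divides by powers of q, which destroys
  precision modulo q^M. Read downwards it only multiplies by powers of q, so agreement at a high
  level, where both families are close to 1, survives down to J = 0.

  Multiplying C(u, J) by the product of 1 - q^m over m > J turns 1 + Q into 1 - Q^2; this is the
  origin of the base q^2 in the binomials. The truncated sums satisfy the recursion only up to one
  boundary term, whose order in q grows with the truncation, so that congruences absorb it.\<close>

definition cong_X :: "nat \<Rightarrow> 'a::comm_ring_1 fps \<Rightarrow> 'a fps \<Rightarrow> bool" where
  "cong_X M f g \<longleftrightarrow> fps_X ^ M dvd f - g"

lemma cong_X_iff_nth: "cong_X M f g \<longleftrightarrow> (\<forall>n<M. f $ n = g $ n)"
proof
  assume "cong_X M f g"
  then obtain h where "f - g = fps_X ^ M * h" by (auto simp: cong_X_def)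
  then have "(f - g) $ n = 0" if "n < M" for n using that by (simp add: fps_X_power_mult_nth)
  then show "\<forall>n<M. f $ n = g $ n" by simp
next
  assume "\<forall>n<M. f $ n = g $ n"
  then have "f - g = fps_X ^ M * fps_shift M (f - g)"
    by (intro fps_ext) (simp add: fps_X_power_mult_nth)
  then show "cong_X M f g" unfolding cong_X_def by (rule dvdI)
qed

lemma cong_X_refl [simp]: "cong_X M f f"
  by (simp add: cong_X_def)

lemma cong_X_sym: "cong_X M f g \<Longrightarrow> cong_X M g f"
  by (simp add: cong_X_iff_nth)

lemma cong_X_trans [trans]: "cong_X M f g \<Longrightarrow> cong_X M g h \<Longrightarrow> cong_X M f h"
  by (simp add: cong_X_iff_nth)

lemma cong_X_mono: "cong_X M f g \<Longrightarrow> M' \<le> M \<Longrightarrow> cong_X M' f g"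
  by (simp add: cong_X_iff_nth)

lemma cong_X_add: "cong_X M f g \<Longrightarrow> cong_X M f' g' \<Longrightarrow> cong_X M (f + f') (g + g')"
  by (simp add: cong_X_iff_nth)

lemma cong_X_diff: "cong_X M f g \<Longrightarrow> cong_X M f' g' \<Longrightarrow> cong_X M (f - f') (g - g')"
  by (simp add: cong_X_iff_nth)

lemma cong_X_mult: "cong_X M f g \<Longrightarrow> cong_X M f' g' \<Longrightarrow> cong_X M (f * f') (g * g')"
  by (simp add: cong_X_iff_nth fps_mult_nth)

lemma cong_X_sum: "(\<And>i. i \<in> A \<Longrightarrow> cong_X M (f i) (g i)) \<Longrightarrow> cong_X M (sum f A) (sum g A)"
  by (simp add: cong_X_iff_nth fps_sum_nth)

lemma cong_X_mult_power_0: "M \<le> e \<Longrightarrow> cong_X M (fps_X ^ e * f) 0"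
  by (simp add: cong_X_iff_nth fps_X_power_mult_nth)

lemma cong_X_power_mult: "cong_X M f g \<Longrightarrow> cong_X (e + M) (fps_X ^ e * f) (fps_X ^ e * g)"
  by (simp add: cong_X_iff_nth fps_X_power_mult_nth)

lemma cong_X_cancel:
  fixes c :: "'a::field fps"
  assumes "c $ 0 \<noteq> 0" "cong_X M (c * f) (c * g)"
  shows "cong_X M f g"
proof -
  have "cong_X M (inverse c * (c * f)) (inverse c * (c * g))"
    by (rule cong_X_mult) (use assms in auto)
  then show ?thesis using assms(1) by (simp add: mult.assoc[symmetric] inverse_mult_eq_1)
qed

section \<open>Infinite products of power series and their images among Laurent series\<close>

definition fps_prodinf :: "(nat \<Rightarrow> 'a::comm_ring_1 fps) \<Rightarrow> 'a fps" where
  "fps_prodinf f = Abs_fps (\<lambda>n. (\<Prod>i<Suc n. f i) $ n)"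

text \<open>Factor \<open>i\<close> is 1 modulo \<open>X^(i+1)\<close>, so coefficient
  \<open>n\<close> of the partial products no longer changes once \<open>n\<close> factors are
  present. This makes the coefficientwise definition of the product the actual limit.\<close>

lemma cong_X_prodinf:
  assumes "\<And>i. cong_X (Suc i) (f i) 1" "M \<le> L"
  shows "cong_X M (\<Prod>i<L. f i) (fps_prodinf f)"
proof -
  have step: "cong_X m (\<Prod>i<l. f i) (\<Prod>i<m. f i)" if "m \<le> l" for m l
    using that
  proof (induction l rule: dec_induct)
    case (step l)
    have "cong_X m ((\<Prod>i<l. f i) * f l) ((\<Prod>i<m. f i) * 1)"
      by (intro cong_X_mult step) (use step assms(1)[of l] in \<open>auto intro: cong_X_mono\<close>)
    then show ?case by simp
  qed simp
  have "(\<Prod>i<L. f i) $ n = (\<Prod>i<Suc n. f i) $ n" if "n < M" for n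
    using step[of "Suc n" L] that assms(2) unfolding cong_X_iff_nth by auto
  then show ?thesis unfolding cong_X_iff_nth fps_prodinf_def by simp
qed

lemma dist_fps_to_fls: "dist (fps_to_fls f) (fps_to_fls g) = dist f g"
  by (auto simp: dist_fls_def dist_fps_def fls_subdegree_fls_to_fps simp flip: fps_to_fls_minus)

text \<open>Stabilising coefficients give convergence in the metric of power series, and the
  embedding into Laurent series is an isometry. The constant term 1 keeps the limit away from 0, as
  \<open>has_prod\<close> demands, and later permits division by the product.\<close>

lemma prodinf_fps_to_fls:
  fixes f :: "nat \<Rightarrow> complex fps"
  assumes "\<And>i. cong_X (Suc i) (f i) 1"
  shows "prodinf (\<lambda>i. fps_to_fls (f i)) = fps_to_fls (fps_prodinf f)" and "fps_prodinf f \<noteq> 0"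
proof -
  have "f 0 $ 0 = 1" using assms[of 0] by (simp add: cong_X_iff_nth)
  then have "fps_prodinf f $ 0 = 1" by (simp add: fps_prodinf_def)
  then show nz: "fps_prodinf f \<noteq> 0" by auto
  have "(\<lambda>n. \<Prod>i\<le>n. f i) \<longlonglongrightarrow> fps_prodinf f"
  proof (rule tendsto_fpsI)
    fix n
    show "\<forall>\<^sub>F L in sequentially. (\<Prod>i\<le>L. f i) $ n = fps_prodinf f $ n"
      using eventually_ge_at_top[of n]
    proof eventually_elim
      case (elim L)
      then show ?case using cong_X_prodinf[OF assms, of "Suc n" "Suc L"]
        by (simp add: cong_X_iff_nth lessThan_Suc_atMost)
    qed
  qed
  then have "(\<lambda>n. dist (\<Prod>i\<le>n. f i) (fps_prodinf f)) \<longlonglongrightarrow> 0"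
    by (simp add: tendsto_dist_iff[of _ "fps_prodinf f"])
  moreover have "(\<Prod>i\<le>n. fps_to_fls (f i)) = fps_to_fls (\<Prod>i\<le>n. f i)" for n
    by (induction n) (simp_all add: fls_times_fps_to_fls)
  ultimately have "(\<lambda>n. \<Prod>i\<le>n. fps_to_fls (f i)) \<longlonglongrightarrow> fps_to_fls (fps_prodinf f)"
    by (simp add: tendsto_dist_iff[of _ "fps_to_fls (fps_prodinf f)"] dist_fps_to_fls)
  then have "(\<lambda>i. fps_to_fls (f i)) has_prod fps_to_fls (fps_prodinf f)"
    using nz by (simp add: has_prod_def raw_has_prod_def)
  then show "prodinf (\<lambda>i. fps_to_fls (f i)) = fps_to_fls (fps_prodinf f)"
    by (rule has_prod_unique[symmetric])
qed

section \<open>The finite Jacobi triple product\<close>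

text \<open>The q-Pascal rule serves as definition, so that no division occurs and the base
  \<open>p\<close> may be any ring element; the bases in use are \<open>X^2\<close> and
  \<open>X^(2k)\<close>.\<close>

fun gauss_binomial :: "'a::comm_ring_1 \<Rightarrow> nat \<Rightarrow> nat \<Rightarrow> 'a" where
  "gauss_binomial p n 0 = 1"
| "gauss_binomial p 0 (Suc j) = 0"
| "gauss_binomial p (Suc n) (Suc j) = gauss_binomial p n (Suc j) + p ^ (n - j) * gauss_binomial p n j"

definition qpoch :: "'a::comm_ring_1 \<Rightarrow> nat \<Rightarrow> 'a" where
  "qpoch p n = (\<Prod>m=1..n. 1 - p ^ m)"

lemma qpoch_0 [simp]: "qpoch p 0 = 1"
  by (simp add: qpoch_def)

lemma qpoch_Suc: "qpoch p (Suc n) = qpoch p n * (1 - p ^ Suc n)"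
  by (simp add: qpoch_def)

lemma gauss_binomial_eq_0: "n < j \<Longrightarrow> gauss_binomial p n j = 0"
  by (induction p n j rule: gauss_binomial.induct) auto

lemma gauss_binomial_self [simp]: "gauss_binomial p n n = 1"
  by (induction n) (auto simp: gauss_binomial_eq_0)

text \<open>The quotient formula in cross-multiplied form. The two summands of the Pascal rule
  contribute \<open>1 - p^b\<close> and \<open>p^b * (1 - p^a)\<close>, which add up to
  \<open>1 - p^(a+b)\<close>.\<close>

lemma gauss_binomial_qpoch:
  "gauss_binomial p (a + b) a * (qpoch p a * qpoch p b) = qpoch p (a + b)"
proof (induction "a + b" arbitrary: a b)
  case 0
  then show ?case by simp
next
  case (Suc n)
  show ?case
  proof (cases a)
    case 0
    then show ?thesis by simp
  next
    case (Suc a')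
    note a = this
    show ?thesis
    proof (cases b)
      case 0
      then show ?thesis by simp
    next
      case (Suc b')
      have 1: "gauss_binomial p (a' + b) a' * (qpoch p a' * qpoch p b) = qpoch p (a' + b)"
        using Suc.hyps(1)[of a' b] Suc.hyps(2) a by simp
      have 2: "gauss_binomial p (a + b') a * (qpoch p a * qpoch p b') = qpoch p (a + b')"
        using Suc.hyps(1)[of a b'] Suc.hyps(2) Suc by simp
      have n: "a' + b = a + b'" "a + b = Suc (a + b')" using a Suc by auto
      have "gauss_binomial p (a + b) a * (qpoch p a * qpoch p b)
        = gauss_binomial p (a + b') a * (qpoch p a * qpoch p b)
          + p ^ b * gauss_binomial p (a + b') a' * (qpoch p a * qpoch p b)"
        using a Suc by (simp add: algebra_simps)
      also have "gauss_binomial p (a + b') a * (qpoch p a * qpoch p b) =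
         gauss_binomial p (a + b') a * (qpoch p a * qpoch p b') * (1 - p ^ b)"
        using Suc by (simp add: qpoch_Suc algebra_simps)
      also have "\<dots> = qpoch p (a + b') * (1 - p ^ b)" by (simp add: 2)
      also have "p ^ b * gauss_binomial p (a + b') a' * (qpoch p a * qpoch p b) =
         p ^ b * (1 - p ^ a) * (gauss_binomial p (a + b') a' * (qpoch p a' * qpoch p b))"
        using a by (simp add: qpoch_Suc algebra_simps)
      also have "\<dots> = p ^ b * (1 - p ^ a) * qpoch p (a + b')" using 1 n by simp
      also have "qpoch p (a + b') * (1 - p ^ b) + \<dots> = qpoch p (a + b') * (1 - p ^ (a + b))"
        by (simp add: algebra_simps power_add)
      also have "\<dots> = qpoch p (a + b)" using n by (simp add: qpoch_Suc)
      finally show ?thesis .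
    qed
  qed
qed

text \<open>Rothe's q-binomial theorem in homogeneous form. Under the Pascal rule the summand for
  \<open>Suc j\<close> splits in two; since \<open>Suc j choose 2\<close> equals
  \<open>j + (j choose 2)\<close>, the parts containing \<open>p ^ (n - j)\<close> collect to
  \<open>y * p ^ n\<close> times the previous sum, and the others to \<open>x\<close> times
  it.\<close>

lemma gauss_binomial_theorem:
  "(\<Prod>m<n. x + y * p ^ m) = (\<Sum>j\<le>n. p ^ (j choose 2) * gauss_binomial p n j * x ^ (n - j) * y ^ j)"
proof (induction n)
  case 0
  then show ?case by (simp add: numeral_2_eq_2)
next
  case (Suc n)
  let ?t = "\<lambda>n j. p ^ (j choose 2) * gauss_binomial p n j * x ^ (n - j) * y ^ j"
  have "(\<Sum>j\<le>Suc n. ?t (Suc n) j) = ?t (Suc n) 0 + (\<Sum>j\<le>n. ?t (Suc n) (Suc j))"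
    by (rule sum.atMost_Suc_shift)
  also have "(\<Sum>j\<le>n. ?t (Suc n) (Suc j)) =
      (\<Sum>j\<le>n. p ^ (Suc j choose 2) * gauss_binomial p n (Suc j) * x ^ (n - j) * y ^ Suc j) +
      (\<Sum>j\<le>n. y * p ^ n * ?t n j)"
  proof -
    have "?t (Suc n) (Suc j) = p ^ (Suc j choose 2) * gauss_binomial p n (Suc j) * x ^ (n - j) * y ^ Suc j
        + y * p ^ n * ?t n j" if "j \<le> n" for j
    proof -
      have "p ^ (Suc j choose 2) * p ^ (n - j) = p ^ n * p ^ (j choose 2)"
        using that by (simp add: numeral_2_eq_2 add.commute flip: power_add)
      then show ?thesis by (simp add: algebra_simps)
    qed
    then show ?thesis by (simp add: sum.distrib)
  qed
  also have "?t (Suc n) 0 + (\<dots>) = (\<Sum>j\<le>Suc n. p ^ (j choose 2) * gauss_binomial p n j * x ^ (Suc n - j) * y ^ j)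
     + (\<Sum>j\<le>n. y * p ^ n * ?t n j)"
    by (subst sum.atMost_Suc_shift) (simp add: add.assoc)
  also have "(\<Sum>j\<le>Suc n. p ^ (j choose 2) * gauss_binomial p n j * x ^ (Suc n - j) * y ^ j) =
      (\<Sum>j\<le>n. x * ?t n j)"
  proof -
    have "p ^ (j choose 2) * gauss_binomial p n j * x ^ (Suc n - j) * y ^ j = x * ?t n j" if "j \<le> n" for j
      using that by (simp add: Suc_diff_le algebra_simps)
    then show ?thesis by (simp add: gauss_binomial_eq_0)
  qed
  also have "\<dots> + (\<Sum>j\<le>n. y * p ^ n * ?t n j) = (\<Prod>m<n. x + y * p ^ m) * (x + y * p ^ n)"
    by (simp add: Suc sum_distrib_left[symmetric] algebra_simps)
  finally show ?case by simp
qed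

lemma choose_two_add: "(a + b) choose 2 = (a choose 2) + (b choose 2) + a * b"
  by (induction b) (auto simp: numeral_2_eq_2 algebra_simps)

text \<open>The two-variable \<open>q\<close>-binomial theorem with \<open>x = p ^ N\<close> and \<open>y = - v\<close>, where \<open>p = u * v\<close>, so that
  no negative powers are needed; the factor \<open>p ^ (N * N + (N choose 2)) * v ^ N\<close> cancels.\<close>

lemma finite_jacobi_triple_product:
  fixes u v :: "'a::idom"
  assumes p: "p = u * v" and "p \<noteq> 0"
  shows "(\<Prod>m<N. (1 - u * p ^ m) * (1 - v * p ^ m)) =
    gauss_binomial p (2 * N) N +
    (\<Sum>n=1..N. (-1) ^ n * p ^ (n choose 2) *
        (u ^ n * gauss_binomial p (2 * N) (N - n) + v ^ n * gauss_binomial p (2 * N) (N + n)))"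
proof -
  define c where "c = p ^ (N * N + (N choose 2)) * (-v) ^ N"
  let ?g = "gauss_binomial p (2 * N)"
  let ?t = "\<lambda>j. p ^ (j choose 2) * ?g j * (p ^ N) ^ (2 * N - j) * (-v) ^ j"
  have "v \<noteq> 0" using assms by auto
  then have c0: "c \<noteq> 0" using assms by (simp add: c_def)
  \<comment> \<open>For \<open>m < N\<close> the power \<open>p ^ N\<close> contains
    \<open>p ^ m * u * v * p ^ (N - Suc m)\<close>, so \<open>p ^ m * (-v)\<close> can be taken out
    and a factor in \<open>u\<close> remains; the order of these factors is then reversed.\<close>
  have low: "(\<Prod>m<N. p ^ N + - v * p ^ m) = p ^ (N choose 2) * (-v) ^ N * (\<Prod>m<N. 1 - u * p ^ m)"
  proof -
    have "(\<Prod>m<N. p ^ N + - v * p ^ m) = (\<Prod>m<N. p ^ m * ((-v) * (1 - u * p ^ (N - Suc m))))"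
    proof (rule prod.cong)
      fix m assume "m \<in> {..<N}"
      then have "N = m + 1 + (N - Suc m)" by simp
      then have "p ^ N = p ^ m * p * p ^ (N - Suc m)"
        by (metis power_add power_one_right)
      then show "p ^ N + - v * p ^ m = p ^ m * ((-v) * (1 - u * p ^ (N - Suc m)))"
        by (simp add: algebra_simps p)
    qed auto
    also have "\<dots> = (\<Prod>m<N. p ^ m) * ((-v) ^ N * (\<Prod>m<N. 1 - u * p ^ (N - Suc m)))"
      by (simp only: prod.distrib prod_constant card_lessThan)
    also have "(\<Prod>m<N. 1 - u * p ^ (N - Suc m)) = (\<Prod>m<N. 1 - u * p ^ m)"
      by (rule prod.nat_diff_reindex)
    also have "(\<Prod>m<N. p ^ m) = p ^ (N choose 2)"
      by (induction N) (auto simp: numeral_2_eq_2 power_add)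
    finally show ?thesis by (simp add: mult.assoc)
  qed
  have high: "(\<Prod>m<N. p ^ N + - v * p ^ (N + m)) = p ^ (N * N) * (\<Prod>m<N. 1 - v * p ^ m)"
  proof -
    have "(\<Prod>m<N. p ^ N + - v * p ^ (N + m)) = (\<Prod>m<N. p ^ N * (1 - v * p ^ m))"
      by (intro prod.cong) (auto simp: algebra_simps power_add)
    then show ?thesis by (simp add: prod.distrib power_mult)
  qed
  have "(\<Prod>m<N + N. p ^ N + - v * p ^ m) = (\<Prod>m<N. p ^ N + - v * p ^ m) * (\<Prod>m<N. p ^ N + - v * p ^ (N + m))"
    by (simp only: prod.nat_group lessThan_atLeast0 prod.atLeastLessThan_concat[of 0 N "N+N", symmetric])
       (simp add: prod.shift_bounds_nat_ivl[of _ 0 N N, simplified] add.commute)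
  then have "(\<Prod>m<N + N. p ^ N + - v * p ^ m) = c * (\<Prod>m<N. (1 - u * p ^ m) * (1 - v * p ^ m))"
    unfolding low high by (simp only: c_def power_add prod.distrib mult_ac)
  then have lhs: "(\<Prod>m<2 * N. p ^ N + - v * p ^ m) = c * (\<Prod>m<N. (1 - u * p ^ m) * (1 - v * p ^ m))"
    by (simp only: mult_2)
  have t0: "?t N = c * ?g N"
    by (simp add: c_def power_add power_mult mult_2 algebra_simps)
  have tplus: "?t (N + n) = c * ((-1) ^ n * p ^ (n choose 2) * (v ^ n * ?g (N + n)))" if "n \<le> N" for n
  proof -
    have "2 * N - (N + n) = N - n" by simp
    moreover have "((N + n) choose 2) + N * (N - n) = N * N + (N choose 2) + (n choose 2)"
      using that by (simp add: choose_two_add diff_mult_distrib2)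
    then have "p ^ ((N + n) choose 2) * (p ^ N) ^ (N - n) = p ^ (N * N + (N choose 2)) * p ^ (n choose 2)"
      by (simp flip: power_mult power_add)
    moreover have "(-v) ^ (N + n) = (-v) ^ N * ((-1) ^ n * v ^ n)"
      by (simp add: power_add power_minus[of v n])
    ultimately show ?thesis unfolding c_def by (simp add: ac_simps)
  qed
  have tminus: "?t (N - n) = c * ((-1) ^ n * p ^ (n choose 2) * (u ^ n * ?g (N - n)))" if "n \<le> N" for n
  proof -
    obtain d where d: "N = d + n" using \<open>n \<le> N\<close> by (metis add.commute le_Suc_ex)
    have "2 * N - (N - n) = N + n" using that by simp
    moreover have "((N - n) choose 2) + N * (N + n) = N * N + (N choose 2) + (n choose 2) + n"
    proof -
      have "n * n = 2 * (n choose 2) + n"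
        by (induction n) (auto simp: numeral_2_eq_2)
      then show ?thesis unfolding d by (simp add: choose_two_add algebra_simps)
    qed
    then have "p ^ ((N - n) choose 2) * (p ^ N) ^ (N + n) = p ^ (N * N + (N choose 2)) * p ^ (n choose 2) * p ^ n"
      by (simp flip: power_mult power_add)
    \<comment> \<open>The surplus \<open>p ^ n = u ^ n * v ^ n\<close> fills
      \<open>(-v) ^ (N - n)\<close> up to the power in \<open>c\<close> and leaves
      \<open>u ^ n\<close>.\<close>
    moreover have "p ^ n * (-v) ^ (N - n) = (-v) ^ N * ((-1) ^ n * u ^ n)"
    proof -
      have "(-v) ^ n * (-1) ^ n = v ^ n" by (simp flip: power_mult_distrib)
      then have pn: "p ^ n = u ^ n * ((-v) ^ n * (-1) ^ n)" by (simp only: p power_mult_distrib)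
      have "N - n = d" "(-v) ^ N = (-v) ^ d * (-v) ^ n" by (simp_all add: d power_add)
      then show ?thesis unfolding pn by (simp only: mult_ac)
    qed
    ultimately show ?thesis unfolding c_def by (simp add: ac_simps)
  qed
  have "(\<Sum>j\<le>2 * N. ?t j) = (\<Sum>j<N. ?t j) + (?t N + (\<Sum>j=Suc N..N + N. ?t j))"
  proof -
    have "{..2 * N} = {..<N} \<union> {N..N + N}" by auto
    then have "(\<Sum>j\<le>2 * N. ?t j) = (\<Sum>j<N. ?t j) + (\<Sum>j=N..N + N. ?t j)"
      by (simp only:) (rule sum.union_disjoint, auto)
    then show ?thesis by (simp only: sum.atLeast_Suc_atMost[of N "N + N"] le_add1)
  qed
  also have "(\<Sum>j<N. ?t j) = (\<Sum>n=1..N. ?t (N - n))"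
    by (rule sum.reindex_bij_witness[of _ "\<lambda>n. N - n" "\<lambda>n. N - n"]) auto
  also have "(\<Sum>j=Suc N..N + N. ?t j) = (\<Sum>n=1..N. ?t (N + n))"
    by (rule sum.reindex_bij_witness[of _ "\<lambda>n. N + n" "\<lambda>n. n - N"]) auto
  also have "(\<Sum>n=1..N. ?t (N - n)) + (?t N + (\<Sum>n=1..N. ?t (N + n))) =
     c * (?g N + (\<Sum>n=1..N. (-1) ^ n * p ^ (n choose 2) * (u ^ n * ?g (N - n) + v ^ n * ?g (N + n))))"
  proof -
    have 1: "(\<Sum>n=1..N. ?t (N - n)) = (\<Sum>n=1..N. c * ((-1) ^ n * p ^ (n choose 2) * (u ^ n * ?g (N - n))))"
      by (rule sum.cong[OF refl], rule tminus) auto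
    have 2: "(\<Sum>n=1..N. ?t (N + n)) = (\<Sum>n=1..N. c * ((-1) ^ n * p ^ (n choose 2) * (v ^ n * ?g (N + n))))"
      by (rule sum.cong[OF refl], rule tplus) auto
    show ?thesis unfolding 1 2 t0
      by (simp add: distrib_left sum.distrib sum_distrib_left algebra_simps)
  qed
  finally have "c * (\<Prod>m<N. (1 - u * p ^ m) * (1 - v * p ^ m)) =
     c * (?g N + (\<Sum>n=1..N. (-1) ^ n * p ^ (n choose 2) * (u ^ n * ?g (N - n) + v ^ n * ?g (N + n))))"
    unfolding lhs[symmetric] gauss_binomial_theorem .
  with c0 show ?thesis by simp
qed

section \<open>An explicit solution of the recursion\<close>

text \<open>The closed form comes from the ansatz \<open>\<Sum>n. A n * (1 / q ^ (u * n) - (x * q) ^ u * q ^ (u * n))\<close> with \<open>x = q ^ J\<close>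
  for a solution of the recursion satisfied by the generating functions. The prefactor
  \<open>1 / ((1 - q ^ (J + 1)) * (1 - q ^ (J + 2)) * \<dots>)\<close> is left out.\<close>

definition closed_term :: "nat \<Rightarrow> nat \<Rightarrow> nat \<Rightarrow> nat \<Rightarrow> complex fps" where
  "closed_term k u J n = (-1) ^ n * gauss_binomial (fps_X ^ 2) (J + n) n *
     (fps_X ^ (J * (k - 1) * n + k * n * n + (k - u) * n)
      - fps_X ^ (J * (k - 1) * n + k * n * (n + 1) + (J + 1 + n) * u))"

definition closed_sum :: "nat \<Rightarrow> nat \<Rightarrow> nat \<Rightarrow> nat \<Rightarrow> complex fps" where
  "closed_sum k N u J = (\<Sum>n<N. closed_term k u J n)"

text \<open>All sides become \<open>qpoch p (Suc (n + J))\<close> after multiplication by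
  \<open>qpoch p n * qpoch p J\<close>, which is nonzero since \<open>p\<close> is no root of unity.
  The first identity moves the binomial of term \<open>n\<close> to level \<open>Suc J\<close>; the
  second does so for term \<open>Suc n\<close> and lowers its index to \<open>n\<close>.\<close>

lemma gauss_binomial_absorb:
  fixes p :: "'a::idom"
  assumes "\<And>m. m > 0 \<Longrightarrow> p ^ m \<noteq> 1"
  shows "gauss_binomial p (Suc J + n) n * (1 - p ^ Suc J) = gauss_binomial p (J + n) n * (1 - p ^ Suc (J + n))"
    and "gauss_binomial p (J + Suc n) (Suc n) * (1 - p ^ Suc n) = gauss_binomial p (Suc J + n) n * (1 - p ^ Suc J)"
proof -
  have nz: "qpoch p m \<noteq> 0" for m using assms by (auto simp: qpoch_def)
  let ?D = "qpoch p n * qpoch p J"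
  have D: "?D \<noteq> 0" using nz by simp
  have 1: "gauss_binomial p (Suc J + n) n * (1 - p ^ Suc J) * ?D = qpoch p (Suc (n + J))"
    using gauss_binomial_qpoch[of p n "Suc J"] by (simp add: qpoch_Suc algebra_simps)
  have 2: "gauss_binomial p (J + n) n * (1 - p ^ Suc (J + n)) * ?D = qpoch p (Suc (n + J))"
    using gauss_binomial_qpoch[of p n J] by (simp add: qpoch_Suc algebra_simps)
  have 3: "gauss_binomial p (J + Suc n) (Suc n) * (1 - p ^ Suc n) * ?D = qpoch p (Suc (n + J))"
    using gauss_binomial_qpoch[of p "Suc n" J] by (simp add: qpoch_Suc algebra_simps)
  show "gauss_binomial p (Suc J + n) n * (1 - p ^ Suc J) = gauss_binomial p (J + n) n * (1 - p ^ Suc (J + n))"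
    using 1 2 D mult_right_cancel by metis
  show "gauss_binomial p (J + Suc n) (Suc n) * (1 - p ^ Suc n) = gauss_binomial p (Suc J + n) n * (1 - p ^ Suc J)"
    using 1 3 D mult_right_cancel by metis
qed

lemma fps_X_power_neq_1: "m > 0 \<Longrightarrow> ((fps_X :: complex fps) ^ 2) ^ m \<noteq> 1"
proof
  assume "m > 0" and 1: "((fps_X :: complex fps) ^ 2) ^ m = 1"
  then have "((fps_X :: complex fps) ^ (2 * m)) $ 0 = 0" by (simp only: fps_X_power_nth) simp
  then show False unfolding power_mult 1 by simp
qed

lemmas gauss_binomial_absorb_X = gauss_binomial_absorb[of "fps_X ^ 2 :: complex fps", OF fps_X_power_neq_1]

text \<open>The summands share \<open>be\<close>, while the other half is shifted by one place. The
  two finite sums therefore differ only by the boundary value \<open>al N\<close>.\<close>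

lemma telescope_combination:
  fixes f g al be :: "nat \<Rightarrow> 'a::comm_ring_1"
  assumes "\<And>n. f n = al n + be n" "\<And>n. g n = be n + al (Suc n)" "al 0 = 0"
  shows "(\<Sum>n<N. f n) = (\<Sum>n<N. g n) - al N"
proof (induction N)
  case 0
  show ?case by (simp add: assms(3))
next
  case (Suc N)
  then show ?case by (simp add: assms(1)[of N] assms(2)[of N])
qed

text \<open>In the difference of the terms for \<open>u\<close> and \<open>u - 2\<close>, the first
  monomials combine to \<open>al n\<close>, with factor \<open>1 - p^n\<close>, and the second ones
  to \<open>be n\<close>, with factor \<open>1 - p^(J+n+1)\<close>. The absorption identities
  convert \<open>be n\<close> and \<open>al (Suc n)\<close> into the first and second monomial of
  term \<open>n\<close> at level \<open>Suc J\<close>. The factor \<open>1 - p^0\<close> makes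
  \<open>al 0\<close> vanish.\<close>

lemma closed_sum_rec:
  assumes k: "2 \<le> k" and u: "2 \<le> u" "u \<le> k"
  shows "\<exists>e\<ge>N. \<exists>R. closed_sum k N u J = closed_sum k N (u - 2) J
     + fps_X ^ (Suc J * (u - 2)) * (1 - (fps_X ^ 2) ^ Suc J) * closed_sum k N (k + 1 - u) (Suc J) - fps_X ^ e * R"
proof -
  obtain w where w: "u = w + 2" using u le_Suc_ex[of 2 u] by auto
  obtain d where d: "k = w + 2 + d" using u w le_Suc_ex[of u k] by auto
  let ?p = "fps_X ^ 2 :: complex fps"
  define e where "e n = J * (k - 1) * n + k * n * n + d * n" for n
  define al where "al n = (-1) ^ n * gauss_binomial ?p (J + n) n * (1 - ?p ^ n) * fps_X ^ e n" for n
  define be where "be n = (-1) ^ n * gauss_binomial ?p (J + n) n * (1 - ?p ^ Suc (J + n))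
     * fps_X ^ (J * (k - 1) * n + k * n * (n + 1) + (J + 1 + n) * w)" for n
  have f: "closed_term k u J n - closed_term k (u - 2) J n = al n + be n" for n
  proof -
    have k1: "k - u = d" "k - (u - 2) = d + 2" "u - 2 = w" using w d by auto
    have 1: "fps_X ^ (J * (k - 1) * n + k * n * n + (k - (u - 2)) * n) = (fps_X ^ e n * ?p ^ n :: complex fps)"
      unfolding k1(2) e_def by (simp add: algebra_simps flip: power_mult power_add)
    have 2: "fps_X ^ (J * (k - 1) * n + k * n * (n + 1) + (J + 1 + n) * u) =
      (fps_X ^ (J * (k - 1) * n + k * n * (n + 1) + (J + 1 + n) * w) * ?p ^ Suc (J + n) :: complex fps)"
      unfolding w power_mult[symmetric] power_add[symmetric] by (simp add: algebra_simps)
    show ?thesis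
      unfolding closed_term_def unfolding 1 2 unfolding k1 al_def be_def unfolding e_def[symmetric]
          by (simp add: algebra_simps)
  qed
  have be: "be n = (-1) ^ n * (gauss_binomial ?p (Suc J + n) n * (1 - ?p ^ Suc J))
       * fps_X ^ (J * (k - 1) * n + k * n * (n + 1) + (J + 1 + n) * w)" for n
    using gauss_binomial_absorb_X(1)[of J n] by (simp only: be_def mult.assoc[of "(-1) ^ n"])
  have al: "al (Suc n) = - ((-1) ^ n * (gauss_binomial ?p (Suc J + n) n * (1 - ?p ^ Suc J)) * fps_X ^ e (Suc n))" for n
    using gauss_binomial_absorb_X(2)[of J n] by (simp only: al_def mult.assoc[of "(-1) ^ Suc n"]) simp
  have g: "fps_X ^ (Suc J * (u - 2)) * (1 - ?p ^ Suc J) * closed_term k (k + 1 - u) (Suc J) n = be n + al (Suc n)" for n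
  proof -
    have k1: "k + 1 - u = Suc d" "k - Suc d = w + 1" "u - 2 = w" "k - 1 = w + 1 + d" using w d by auto
    have 1: "fps_X ^ (Suc J * w) * fps_X ^ (Suc J * (k - 1) * n + k * n * n + (w + 1) * n) =
       (fps_X ^ (J * (k - 1) * n + k * n * (n + 1) + (J + 1 + n) * w) :: complex fps)"
      unfolding k1 power_add[symmetric] by (rule arg_cong[of _ _ "power fps_X"]) (simp add: d algebra_simps)
    have 2: "fps_X ^ (Suc J * w) * fps_X ^ (Suc J * (k - 1) * n + k * n * (n + 1) + (Suc J + 1 + n) * Suc d) =
       (fps_X ^ e (Suc n) :: complex fps)"
      unfolding k1 power_add[symmetric] e_def by (rule arg_cong[of _ _ "power fps_X"]) (simp add: d algebra_simps)
    have "fps_X ^ (Suc J * (u - 2)) * (1 - ?p ^ Suc J) * closed_term k (k + 1 - u) (Suc J) n =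
      (-1) ^ n * (gauss_binomial ?p (Suc J + n) n * (1 - ?p ^ Suc J)) *
       (fps_X ^ (Suc J * w) * fps_X ^ (Suc J * (k - 1) * n + k * n * n + (w + 1) * n)
       - fps_X ^ (Suc J * w) * fps_X ^ (Suc J * (k - 1) * n + k * n * (n + 1) + (Suc J + 1 + n) * Suc d))"
      unfolding closed_term_def k1(1-3) by (simp only: algebra_simps)
    also have "\<dots> = (-1) ^ n * (gauss_binomial ?p (Suc J + n) n * (1 - ?p ^ Suc J))
        * fps_X ^ (J * (k - 1) * n + k * n * (n + 1) + (J + 1 + n) * w)
       - (-1) ^ n * (gauss_binomial ?p (Suc J + n) n * (1 - ?p ^ Suc J)) * fps_X ^ e (Suc n)"
      unfolding 1 2 by (simp only: right_diff_distrib)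
    also have "\<dots> = be n + al (Suc n)"
      unfolding be al by simp
    finally show ?thesis .
  qed
  have aux: "a = b + c - d" if "a - b = c - d" for a b c d :: "complex fps"
    using that by (simp add: algebra_simps)
  have "(\<Sum>n<N. closed_term k u J n - closed_term k (u - 2) J n) =
     (\<Sum>n<N. fps_X ^ (Suc J * (u - 2)) * (1 - ?p ^ Suc J) * closed_term k (k + 1 - u) (Suc J) n) - al N"
    by (rule telescope_combination[of _ al be]) (use f g in \<open>auto simp: al_def\<close>)
  also have "al N = fps_X ^ e N * ((-1) ^ N * gauss_binomial ?p (J + N) N * (1 - ?p ^ N))"
    by (simp add: al_def mult_ac)
  finally have "closed_sum k N u J = closed_sum k N (u - 2) J
     + fps_X ^ (Suc J * (u - 2)) * (1 - ?p ^ Suc J) * closed_sum k N (k + 1 - u) (Suc J)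
     - fps_X ^ e N * ((-1) ^ N * gauss_binomial ?p (J + N) N * (1 - ?p ^ N))"
    unfolding sum_subtractf sum_distrib_left[symmetric] closed_sum_def[symmetric]
    by (rule aux)
  \<comment> \<open>The boundary term is negligible because its exponent contains the quadratic part
    \<open>k * N * N\<close>.\<close>
  moreover have "N = 0 \<or> 1 \<le> k * N" using k by auto
  then have "N \<le> k * N * N" by auto
  then have "e N \<ge> N" unfolding e_def by linarith
  ultimately show ?thesis by blast
qed

text \<open>At \<open>u = 0\<close> the two monomials of each term coincide, which matches the empty
  class of partitions.\<close>

lemma closed_sum_0 [simp]: "closed_sum k N 0 J = 0"
proof -
  have e: "J * (k - 1) * n + k * n * n + (k - 0) * n = J * (k - 1) * n + k * n * (n + 1) + (J + 1 + n) * 0" for n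
    by (simp add: algebra_simps)
  show ?thesis unfolding closed_sum_def closed_term_def e by simp
qed

text \<open>At \<open>u = 1\<close> the recursion involves \<open>u - 2 = -1\<close>. The closed form changes by the factor \<open>- (x * q) ^ u\<close>
  under \<open>u \<mapsto> - u\<close>, and this accounts for the factor on the left.\<close>

lemma closed_sum_1:
  assumes k: "2 \<le> k"
  shows "\<exists>e\<ge>N. \<exists>R. (1 + fps_X ^ Suc J) * closed_sum k N 1 J =
     (1 - (fps_X ^ 2) ^ Suc J) * closed_sum k N k (Suc J) - fps_X ^ e * R"
proof -
  obtain d where d: "k = Suc d" using k by (cases k) auto
  let ?p = "fps_X ^ 2 :: complex fps"
  define e where "e n = J * d * n + k * n * n + d * n" for n
  define al where "al n = (-1) ^ n * gauss_binomial ?p (J + n) n * (1 - ?p ^ n) * fps_X ^ (Suc J + e n)" for n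
  define be where "be n = (-1) ^ n * gauss_binomial ?p (J + n) n * (1 - ?p ^ Suc (J + n)) * fps_X ^ e n" for n
  \<comment> \<open>This regrouping of \<open>(1 + Q) * (1 - Q * P)\<close>, used with
    \<open>Q = X^(J+1)\<close> and \<open>P = p^n\<close>, produces exactly the factors
    \<open>1 - p^n\<close> and \<open>1 - p^(J+n+1)\<close> to which the absorption identities
    apply.\<close>
  have aux: "(1 + Q) * (s * g * (E - E * Q * P)) = s * g * (1 - P) * (Q * E) + s * g * (1 - Q * Q * P) * E"
    for Q s g E P :: "complex fps"
    by (simp add: algebra_simps)
  have f: "(1 + fps_X ^ Suc J) * closed_term k 1 J n = al n + be n" for n
  proof -
    have 1: "(fps_X ^ (J * (k - 1) * n + k * n * n + (k - 1) * n) :: complex fps) = fps_X ^ e n"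
      by (simp add: e_def d)
    have 2: "(fps_X ^ (J * (k - 1) * n + k * n * (n + 1) + (J + 1 + n) * 1) :: complex fps)
        = fps_X ^ e n * fps_X ^ Suc J * ?p ^ n"
      unfolding power_mult[symmetric] power_add[symmetric] by (rule arg_cong[of _ _ "power fps_X"]) (simp add: d e_def algebra_simps)
    have 3: "?p ^ Suc (J + n) = fps_X ^ Suc J * fps_X ^ Suc J * ?p ^ n"
      unfolding power_mult[symmetric] power_add[symmetric] by (rule arg_cong[of _ _ "power fps_X"]) simp
    show ?thesis
      unfolding closed_term_def 1 2 al_def be_def 3 power_add[of _ "Suc J"] by (rule aux)
  qed
  have be: "be n = (-1) ^ n * (gauss_binomial ?p (Suc J + n) n * (1 - ?p ^ Suc J)) * fps_X ^ e n" for n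
    using gauss_binomial_absorb_X(1)[of J n] by (simp only: be_def mult.assoc[of "(-1) ^ n"])
  have al: "al (Suc n) = - ((-1) ^ n * (gauss_binomial ?p (Suc J + n) n * (1 - ?p ^ Suc J)) * fps_X ^ (Suc J + e (Suc n)))" for n
    using gauss_binomial_absorb_X(2)[of J n] by (simp only: al_def mult.assoc[of "(-1) ^ Suc n"]) simp
  have g: "(1 - ?p ^ Suc J) * closed_term k k (Suc J) n = be n + al (Suc n)" for n
  proof -
    have 1: "(fps_X ^ (Suc J * (k - 1) * n + k * n * n + (k - k) * n) :: complex fps) = fps_X ^ e n"
      by (rule arg_cong[of _ _ "power fps_X"]) (simp add: d e_def algebra_simps)
    have 2: "(fps_X ^ (Suc J * (k - 1) * n + k * n * (n + 1) + (Suc J + 1 + n) * k) :: complex fps)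
        = fps_X ^ (Suc J + e (Suc n))"
      by (rule arg_cong[of _ _ "power fps_X"]) (simp add: d e_def algebra_simps)
    have "(1 - ?p ^ Suc J) * closed_term k k (Suc J) n =
        (-1) ^ n * (gauss_binomial ?p (Suc J + n) n * (1 - ?p ^ Suc J)) * fps_X ^ e n
       - (-1) ^ n * (gauss_binomial ?p (Suc J + n) n * (1 - ?p ^ Suc J)) * fps_X ^ (Suc J + e (Suc n))"
      unfolding closed_term_def 1 2 by (simp only: algebra_simps)
    also have "\<dots> = be n + al (Suc n)"
      unfolding be al by simp
    finally show ?thesis .
  qed
  have "(\<Sum>n<N. (1 + fps_X ^ Suc J) * closed_term k 1 J n) =
     (\<Sum>n<N. (1 - ?p ^ Suc J) * closed_term k k (Suc J) n) - al N"
    by (rule telescope_combination[of _ al be]) (use f g in \<open>auto simp: al_def\<close>)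
  also have "al N = fps_X ^ (Suc J + e N) * ((-1) ^ N * gauss_binomial ?p (J + N) N * (1 - ?p ^ N))"
    by (simp add: al_def mult_ac)
  finally have "(1 + fps_X ^ Suc J) * closed_sum k N 1 J = (1 - ?p ^ Suc J) * closed_sum k N k (Suc J)
     - fps_X ^ (Suc J + e N) * ((-1) ^ N * gauss_binomial ?p (J + N) N * (1 - ?p ^ N))"
    unfolding sum_distrib_left[symmetric] closed_sum_def[symmetric] .
  moreover have "N = 0 \<or> 1 \<le> k * N" using k by auto
  then have "N \<le> k * N * N" by auto
  then have "Suc J + e N \<ge> N" unfolding e_def by linarith
  ultimately show ?thesis by blast
qed

section \<open>The recursion for the partition generating functions\<close>

text \<open>Bressoud's form of conditions (1) and (4), in terms of multiplicities; \<open>b\<close> stands for \<open>r + k\<close>.\<close>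

definition bressoud :: "nat \<Rightarrow> nat \<Rightarrow> nat list \<Rightarrow> bool" where
  "bressoud k b \<pi> \<longleftrightarrow> (\<forall>p. count_list \<pi> p + count_list \<pi> (Suc p) \<le> k - 1 \<and>
     (count_list \<pi> p + count_list \<pi> (Suc p) = k - 1 \<longrightarrow>
       even (p * count_list \<pi> p + Suc p * count_list \<pi> (Suc p) + b)))"

lemma bressoud_parity_cong:
  assumes "even (b + c)"
  shows "bressoud k b \<pi> = bressoud k c \<pi>"
proof -
  have "even (x + b) = even (x + c)" for x using assms by auto
  then show ?thesis unfolding bressoud_def by presburger
qed

lemma length_filter_two_values:
  "length (filter (\<lambda>x. x = p \<or> x = Suc p) xs) = count_list xs p + count_list xs (Suc p)"
  by (induction xs) auto

lemma sum_list_filter_two_values: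
  "sum_list (filter (\<lambda>x. x = p \<or> x = Suc p) xs) = p * count_list xs p + Suc p * count_list xs (Suc p)"
  by (induction xs) auto

text \<open>Contiguity of the entries \<open>p\<close> and \<open>Suc p\<close> is what links
  multiplicities to windows of consecutive parts.\<close>

lemma sorted_split_two_values:
  fixes xs :: "nat list"
  assumes "sorted_wrt (\<ge>) xs"
  shows "xs = filter (\<lambda>x. x > Suc p) xs @ filter (\<lambda>x. x = p \<or> x = Suc p) xs @ filter (\<lambda>x. x < p) xs"
  using assms
proof (induction xs)
  case (Cons a xs)
  have le: "\<forall>x\<in>set xs. x \<le> a" and IH: "xs = filter (\<lambda>x. x > Suc p) xs @ filter (\<lambda>x. x = p \<or> x = Suc p) xs @ filter (\<lambda>x. x < p) xs"
    using Cons by auto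
  consider "a > Suc p" | "a = p \<or> a = Suc p" | "a < p" by linarith
  then show ?case
  proof cases
    case 1
    then show ?thesis using IH by simp
  next
    case 2
    then have "filter (\<lambda>x. x > Suc p) xs = []" using le by (auto simp: filter_empty_conv)
    with 2 IH show ?thesis by auto
  next
    case 3
    then have "filter (\<lambda>x. x > Suc p) xs = []" "filter (\<lambda>x. x = p \<or> x = Suc p) xs = []"
      using le by (auto simp: filter_empty_conv)
    with 3 IH show ?thesis by auto
  qed
qed simp

lemma sum_part_window:
  assumes "t \<ge> 1" "l \<ge> 1" "t + l - 1 \<le> length \<pi>"
  shows "(\<Sum>s=t..t + l - 1. part \<pi> s) = sum_list (take l (drop (t - 1) \<pi>))"
proof -
  have "length (take l (drop (t - 1) \<pi>)) = l" using assms by auto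
  then have "sum_list (take l (drop (t - 1) \<pi>)) = (\<Sum>i<l. take l (drop (t - 1) \<pi>) ! i)"
    unfolding sum_list_sum_nth lessThan_atLeast0 by (rule ssubst) (rule refl)
  also have "\<dots> = (\<Sum>i<l. \<pi> ! (t - 1 + i))"
    using assms by (intro sum.cong) auto
  also have "\<dots> = (\<Sum>s=t..t + l - 1. part \<pi> s)"
    using assms by (intro sum.reindex_bij_witness[of _ "\<lambda>s. s - t" "\<lambda>i. t + i"]) auto
  finally show ?thesis by simp
qed

lemma close_window:
  fixes \<pi> :: "nat list"
  assumes s: "sorted_wrt (\<ge>) \<pi>" and t: "t \<ge> 1" "l \<ge> 1" "t + l - 1 \<le> length \<pi>"
    and d: "part \<pi> t - part \<pi> (t + l - 1) \<le> 1"
  defines "p \<equiv> part \<pi> (t + l - 1)"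
  shows "\<forall>x\<in>set (take l (drop (t - 1) \<pi>)). x = p \<or> x = Suc p"
proof
  fix x assume "x \<in> set (take l (drop (t - 1) \<pi>))"
  then obtain i where i: "i < l" "x = \<pi> ! (t - 1 + i)"
    using t by (auto simp: in_set_conv_nth)
  have mono: "\<pi> ! b \<le> \<pi> ! a" if "a \<le> b" "b < length \<pi>" for a b
    using s that by (cases "a = b") (auto simp: sorted_wrt_iff_nth_less)
  have "x \<le> \<pi> ! (t - 1)" "\<pi> ! (t + l - 1 - 1) \<le> x"
    using i t by (auto intro!: mono)
  then show "x = p \<or> x = Suc p" using d unfolding p_def by linarith
qed

lemma two_values_window:
  fixes \<pi> :: "nat list"
  assumes s: "sorted_wrt (\<ge>) \<pi>" and l: "1 \<le> l" "l \<le> count_list \<pi> p + count_list \<pi> (Suc p)"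
  obtains t where "t \<ge> 1" "t + l - 1 \<le> length \<pi>" "part \<pi> t - part \<pi> (t + l - 1) \<le> 1"
    "take l (drop (t - 1) \<pi>) = take l (filter (\<lambda>x. x = p \<or> x = Suc p) \<pi>)"
proof -
  define A where "A = filter (\<lambda>x. x > Suc p) \<pi>"
  define W where "W = filter (\<lambda>x. x = p \<or> x = Suc p) \<pi>"
  define Z where "Z = filter (\<lambda>x. x < p) \<pi>"
  have pi: "\<pi> = A @ W @ Z" unfolding A_def W_def Z_def by (rule sorted_split_two_values[OF s])
  have lW: "l \<le> length W" using l by (simp add: W_def length_filter_two_values)
  have W: "x = p \<or> x = Suc p" if "x \<in> set W" for x using that by (auto simp: W_def)
  have nth: "\<pi> ! (length A + i) = W ! i" if "i < length W" for i
    using that by (simp add: pi nth_append)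
  show ?thesis
  \<comment> \<open>The window starts right after the entries exceeding \<open>Suc p\<close>; parts
    are numbered from 1.\<close>
  proof (rule that[of "Suc (length A)"])
    have len: "0 < length W" "l - 1 < length W" using lW l by auto
    then have "W ! 0 \<in> set W" "W ! (l - 1) \<in> set W" by (auto intro: nth_mem)
    then have "W ! 0 - W ! (l - 1) \<le> 1" using W[of "W ! 0"] W[of "W ! (l - 1)"] by auto
    moreover have "part \<pi> (Suc (length A)) = W ! 0" using nth[OF len(1)] by simp
    moreover have "part \<pi> (Suc (length A) + l - 1) = W ! (l - 1)"
      using nth[OF len(2)] l by simp
    ultimately show "part \<pi> (Suc (length A)) - part \<pi> (Suc (length A) + l - 1) \<le> 1" by simp
    show "Suc (length A) + l - 1 \<le> length \<pi>" using lW by (simp add: pi)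
    show "take l (drop (Suc (length A) - 1) \<pi>) = take l (filter (\<lambda>x. x = p \<or> x = Suc p) \<pi>)"
    proof -
      have "drop (length A) \<pi> = W @ Z" by (simp add: pi)
      then show ?thesis using lW unfolding W_def[symmetric] by simp
    qed
  qed simp
qed

text \<open>A window whose ends differ by at most 1 contains only \<open>p\<close> and
  \<open>Suc p\<close>, where \<open>p\<close> is its last part; conversely these entries form one
  block. So condition (1) bounds the length of such a block by \<open>k - 1\<close>, and condition
  (4) speaks of the blocks that attain this bound.\<close>

lemma window_conditions_iff:
  assumes s: "sorted_wrt (\<ge>) \<pi>" and k: "k \<ge> 2"
  shows "(\<forall>t\<ge>1. t + k - 1 \<le> length \<pi> \<longrightarrow> part \<pi> t - part \<pi> (t + k - 1) \<ge> 2) \<and>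
     (\<forall>t\<ge>1. t + k - 2 \<le> length \<pi> \<longrightarrow> part \<pi> t - part \<pi> (t + k - 2) \<le> 1 \<longrightarrow>
        [(\<Sum>s = t..t + k - 2. part \<pi> s) = b] (mod 2)) \<longleftrightarrow> bressoud k b \<pi>"
    (is "?D \<and> ?P \<longleftrightarrow> _")
proof
  assume DP: "?D \<and> ?P"
  show "bressoud k b \<pi>"
    unfolding bressoud_def
  proof (intro allI conjI impI)
    fix p
    let ?c = "count_list \<pi> p + count_list \<pi> (Suc p)"
    show "?c \<le> k - 1"
    proof (rule ccontr)
      assume "\<not> ?c \<le> k - 1"
      then have "k \<le> ?c" by simp
      from two_values_window[OF s _ this] k obtain t where "t \<ge> 1" "t + k - 1 \<le> length \<pi>"
        "part \<pi> t - part \<pi> (t + k - 1) \<le> 1" by auto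
      with DP show False by fastforce
    qed
    assume c: "?c = k - 1"
    let ?W = "filter (\<lambda>x. x = p \<or> x = Suc p) \<pi>"
    have k1: "t + (k - 1) - 1 = t + k - 2" for t using k by simp
    have "1 \<le> k - 1" using k by simp
    from two_values_window[OF s this eq_refl[OF c[symmetric]]] obtain t where t: "t \<ge> 1" "t + k - 2 \<le> length \<pi>"
        "part \<pi> t - part \<pi> (t + k - 2) \<le> 1" "take (k - 1) (drop (t - 1) \<pi>) = take (k - 1) ?W"
      unfolding k1 by blast
    have "(\<Sum>s = t..t + k - 2. part \<pi> s) = sum_list ?W"
    proof -
      have "length ?W = k - 1" using c by (simp only: length_filter_two_values)
      then have "take (k - 1) ?W = ?W" by simp
      then show ?thesis using sum_part_window[of t "k - 1" \<pi>] t k unfolding k1 by simp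
    qed
    moreover have "[(\<Sum>s = t..t + k - 2. part \<pi> s) = b] (mod 2)" using DP t by blast
    ultimately show "even (p * count_list \<pi> p + Suc p * count_list \<pi> (Suc p) + b)"
      unfolding sum_list_filter_two_values cong_def by presburger
  qed
next
  assume B: "bressoud k b \<pi>"
  have filt: "l \<le> k - 1 \<and> (l = k - 1 \<longrightarrow> even (sum_list (take l (drop (t - 1) \<pi>)) + b))"
    if t: "t \<ge> 1" "l \<ge> 1" "t + l - 1 \<le> length \<pi>" "part \<pi> t - part \<pi> (t + l - 1) \<le> 1" for t l
  proof -
    define p where "p = part \<pi> (t + l - 1)"
    let ?P = "\<lambda>x. x = p \<or> x = Suc p"
    define V where "V = take l (drop (t - 1) \<pi>)"
    have fV: "filter ?P V = V"
      using close_window[OF s t] unfolding V_def p_def by simp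
    have pi: "\<pi> = take (t - 1) \<pi> @ V @ drop l (drop (t - 1) \<pi>)" unfolding V_def
        by (simp only: append_take_drop_id)
    have F: "filter ?P \<pi> = filter ?P (take (t - 1) \<pi>) @ V @ filter ?P (drop l (drop (t - 1) \<pi>))"
      using arg_cong[OF pi, of "filter ?P"] by (simp only: filter_append fV)
    have lV: "length V = l" using t by (simp add: V_def)
    have c: "length (filter ?P \<pi>) \<le> k - 1" using B unfolding length_filter_two_values bressoud_def by blast
    have "length (filter ?P \<pi>) \<ge> l" unfolding F using lV by simp
    \<comment> \<open>The window already has as many entries as \<open>\<pi>\<close> may have in
      \<open>p\<close> and \<open>Suc p\<close> together, so nothing of the block lies outside it
      and the sum of the window is the sum of the block.\<close>
    moreover have "even (sum_list V + b)" if "l = k - 1"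
    proof -
      have len: "length (filter ?P \<pi>) = k - 1" using c that \<open>length (filter ?P \<pi>) \<ge> l\<close> by linarith
      have "length (filter ?P \<pi>) = length (filter ?P (take (t - 1) \<pi>)) + (l + length (filter ?P (drop l (drop (t - 1) \<pi>))))"
        using arg_cong[OF F, of length] lV by (simp only: length_append)
      with len that have "filter ?P (take (t - 1) \<pi>) = []" "filter ?P (drop l (drop (t - 1) \<pi>)) = []"
        unfolding length_0_conv[symmetric] by linarith+
      with F have "filter ?P \<pi> = V" by (simp only: append_Nil append_Nil2)
      then have "sum_list V = p * count_list \<pi> p + Suc p * count_list \<pi> (Suc p)"
        by (metis sum_list_filter_two_values)
      moreover have "even (p * count_list \<pi> p + Suc p * count_list \<pi> (Suc p) + b)"
        using B len unfolding length_filter_two_values bressoud_def by blast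
      ultimately show ?thesis by (simp only:)
    qed
    ultimately show ?thesis using c unfolding V_def by linarith
  qed
  show "?D \<and> ?P"
  proof (intro conjI allI impI)
    fix t :: nat assume t: "t \<ge> 1" "t + k - 1 \<le> length \<pi>"
    show "part \<pi> t - part \<pi> (t + k - 1) \<ge> 2"
    proof (rule ccontr)
      assume "\<not> ?thesis"
      then have "part \<pi> t - part \<pi> (t + k - 1) \<le> 1" by simp
      from filt[OF t(1) _ t(2) this] k show False by linarith
    qed
  next
    fix t :: nat assume t: "t \<ge> 1" "t + k - 2 \<le> length \<pi>" "part \<pi> t - part \<pi> (t + k - 2) \<le> 1"
    have k1: "t + (k - 1) - 1 = t + k - 2" using k by simp
    show "[(\<Sum>s = t..t + k - 2. part \<pi> s) = b] (mod 2)"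
    proof -
      have "even (sum_list (take (k - 1) (drop (t - 1) \<pi>)) + b)" using filt[of t "k - 1"] t k unfolding k1 by simp
      then have "even ((\<Sum>s = t..t + k - 2. part \<pi> s) + b)"
        using sum_part_window[of t "k - 1" \<pi>] t k unfolding k1 by simp
      then show ?thesis unfolding cong_def by presburger
    qed
  qed
qed

lemma count_list_replicate: "count_list (replicate m x) y = (if x = y then m else 0)"
  by (induction m) auto

text \<open>The appended parts affect only the pairs \<open>(J, J+1)\<close> and
  \<open>(J+1, J+2)\<close>. The condition at the second pair implies the one at the first, because
  \<open>m = k - 1\<close> leaves no room for a part \<open>J+2\<close>; in the same way it implies
  the condition on \<open>\<sigma>\<close> alone at that pair.\<close>

lemma bressoud_append:
  assumes big: "\<forall>x\<in>set \<sigma>. Suc J < x"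
  shows "bressoud k b (\<sigma> @ replicate m (Suc J)) \<longleftrightarrow> bressoud k b \<sigma> \<and>
    m + count_list \<sigma> (Suc (Suc J)) \<le> k - 1 \<and>
    (m + count_list \<sigma> (Suc (Suc J)) = k - 1 \<longrightarrow>
       even (Suc J * m + Suc (Suc J) * count_list \<sigma> (Suc (Suc J)) + b))" (is "?L = ?R")
proof -
  let ?\<pi> = "\<sigma> @ replicate m (Suc J)"
  have z: "count_list \<sigma> p = 0" if "p \<le> Suc J" for p
    using big that by (auto simp: count_list_0_iff)
  have c: "count_list ?\<pi> p = (if p = Suc J then m else count_list \<sigma> p)" for p
    by (auto simp: count_list_replicate z)
  let ?Q = "\<lambda>x y p. x + y \<le> k - 1 \<and> (x + y = k - 1 \<longrightarrow> even (p * x + Suc p * y + b))"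
  have L: "?L \<longleftrightarrow> (\<forall>p. ?Q (count_list ?\<pi> p) (count_list ?\<pi> (Suc p)) p)"
      by (simp only: bressoud_def)
  have R: "bressoud k b \<sigma> \<longleftrightarrow> (\<forall>p. ?Q (count_list \<sigma> p) (count_list \<sigma> (Suc p)) p)"
      by (simp only: bressoud_def)
  let ?c = "count_list \<sigma> (Suc (Suc J))"
  show ?thesis
  proof
    assume l: ?L
    then have Q: "?Q (count_list ?\<pi> p) (count_list ?\<pi> (Suc p)) p" for p using L by blast
    have J1: "?Q m ?c (Suc J)" using Q[of "Suc J"] unfolding c by simp
    have "?Q (count_list \<sigma> p) (count_list \<sigma> (Suc p)) p" for p
    proof -
      consider "p = J" | "p = Suc J" | "p \<noteq> J" "p \<noteq> Suc J" by blast
      then show ?thesis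
      proof cases
        case 1
        have "even b" if "k - 1 = 0" using J1 that by auto
        then show ?thesis using 1 z[of J] z[of "Suc J"] by simp
      next
        case 2
        have "even (Suc (Suc J) * ?c + b)" if c: "?c = k - 1"
        proof -
          have "m = 0" using J1 c by linarith
          moreover have "even (Suc J * m + Suc (Suc J) * ?c + b)" using J1 c by linarith
          ultimately show ?thesis by simp
        qed
        then show ?thesis using 2 J1 z[of "Suc J"] by simp
      next
        case 3
        then show ?thesis using Q[of p] unfolding c by simp
      qed
    qed
    then show ?R unfolding R using J1 by simp
  next
    assume r: ?R
    then have Q: "?Q (count_list \<sigma> p) (count_list \<sigma> (Suc p)) p" for p using R by blast
    have "?Q (count_list ?\<pi> p) (count_list ?\<pi> (Suc p)) p" for p
    proof -
      consider "p = J" | "p = Suc J" | "p \<noteq> J" "p \<noteq> Suc J" by blast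
      then show ?thesis
      proof cases
        case 1
        have "even (Suc J * m + b)" if m: "m = k - 1"
        proof -
          have "?c = 0" using r m by linarith
          moreover have "even (Suc J * m + Suc (Suc J) * ?c + b)" using r \<open>?c = 0\<close> m by linarith
          ultimately show ?thesis by simp
        qed
        then show ?thesis unfolding c using 1 r z[of J] by simp
      next
        case 2
        then show ?thesis unfolding c using r by simp
      next
        case 3
        then show ?thesis using Q[of p] unfolding c by simp
      qed
    qed
    then show ?L unfolding L by blast
  qed
qed

section \<open>Generating functions of classes of partitions\<close>

definition partition_gf :: "(nat list \<Rightarrow> bool) \<Rightarrow> complex fps" where
  "partition_gf \<Phi> = Abs_fps (\<lambda>n. of_nat (card {\<pi>. is_partition n \<pi> \<and> \<Phi> \<pi>}))"

lemma finite_partitions: "finite {\<pi>. is_partition n \<pi> \<and> \<Phi> \<pi>}"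
proof (rule finite_subset)
  have "length \<pi> \<le> sum_list \<pi>" if "\<forall>p\<in>set \<pi>. p > 0" for \<pi> :: "nat list"
    using that by (induction \<pi>) auto
  then show "{\<pi>. is_partition n \<pi> \<and> \<Phi> \<pi>} \<subseteq> {\<pi>. set \<pi> \<subseteq> {..n} \<and> length \<pi> \<le> n}"
    by (auto simp: is_partition_def member_le_sum_list)
  show "finite {\<pi>. set \<pi> \<subseteq> {..n} \<and> length \<pi> \<le> n}"
    by (rule finite_lists_length_le) simp
qed

lemma partition_gf_cong:
  assumes "\<And>n \<pi>. is_partition n \<pi> \<Longrightarrow> \<Phi> \<pi> = \<Psi> \<pi>"
  shows "partition_gf \<Phi> = partition_gf \<Psi>"
proof -
  have "{\<pi>. is_partition n \<pi> \<and> \<Phi> \<pi>} = {\<pi>. is_partition n \<pi> \<and> \<Psi> \<pi>}" for n using assms by auto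
  then show ?thesis by (simp add: partition_gf_def)
qed

lemma partition_gf_disj:
  assumes "\<And>n \<pi>. is_partition n \<pi> \<Longrightarrow> \<not> (\<Phi> \<pi> \<and> \<Psi> \<pi>)"
  shows "partition_gf (\<lambda>\<pi>. \<Phi> \<pi> \<or> \<Psi> \<pi>) = partition_gf \<Phi> + partition_gf \<Psi>"
proof -
  have "card {\<pi>. is_partition n \<pi> \<and> (\<Phi> \<pi> \<or> \<Psi> \<pi>)} =
    card {\<pi>. is_partition n \<pi> \<and> \<Phi> \<pi>} + card {\<pi>. is_partition n \<pi> \<and> \<Psi> \<pi>}" for n
    by (subst card_Un_disjoint[symmetric])
       (use assms in \<open>auto intro!: finite_partitions arg_cong[of _ _ card]\<close>)
  then show ?thesis by (simp add: partition_gf_def fps_eq_iff)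
qed

lemma partition_gf_append:
  assumes big: "\<And>\<sigma>. \<Phi> \<sigma> \<Longrightarrow> \<forall>x\<in>set \<sigma>. a \<le> x" and "a > 0"
  shows "partition_gf (\<lambda>\<pi>. \<exists>\<sigma>. \<pi> = \<sigma> @ replicate m a \<and> \<Phi> \<sigma>) = fps_X ^ (a * m) * partition_gf \<Phi>"
proof (rule fps_ext)
  fix n
  have p: "is_partition n (\<sigma> @ replicate m a) \<longleftrightarrow> a * m \<le> n \<and> is_partition (n - a * m) \<sigma>" if "\<Phi> \<sigma>" for \<sigma>
  proof -
    have "sorted_wrt (\<ge>) (replicate m a)" by (induction m) auto
    then have "sorted_wrt (\<ge>) (\<sigma> @ replicate m a) \<longleftrightarrow> sorted_wrt (\<ge>) \<sigma>"
      using big[OF that] by (auto simp: sorted_wrt_append)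
    moreover have "(\<forall>x\<in>set (\<sigma> @ replicate m a). 0 < x) \<longleftrightarrow> (\<forall>x\<in>set \<sigma>. 0 < x)"
      using \<open>a > 0\<close> by auto
    moreover have "sum_list (\<sigma> @ replicate m a) = n \<longleftrightarrow> a * m \<le> n \<and> sum_list \<sigma> = n - a * m"
      by (auto simp: sum_list_replicate mult.commute)
    ultimately show ?thesis unfolding is_partition_def by blast
  qed
  have e: "{\<pi>. is_partition n \<pi> \<and> (\<exists>\<sigma>. \<pi> = \<sigma> @ replicate m a \<and> \<Phi> \<sigma>)} =
     (if a * m \<le> n then (\<lambda>\<sigma>. \<sigma> @ replicate m a) ` {\<sigma>. is_partition (n - a * m) \<sigma> \<and> \<Phi> \<sigma>} else {})"
    using p by auto
  show "partition_gf (\<lambda>\<pi>. \<exists>\<sigma>. \<pi> = \<sigma> @ replicate m a \<and> \<Phi> \<sigma>) $ n = (fps_X ^ (a * m) * partition_gf \<Phi>) $ n"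
    unfolding partition_gf_def fps_nth_Abs_fps e fps_X_power_mult_nth
    by (auto simp: card_image inj_on_def)
qed

text \<open>The parameter is \<open>u = k - i + 1\<close>; then \<open>u = 0\<close> gives the zero series, which is how the missing term in
  the definition of the last ghost series is covered.\<close>

definition admissible :: "nat \<Rightarrow> nat \<Rightarrow> nat \<Rightarrow> nat list \<Rightarrow> bool" where
  "admissible k u J \<pi> \<longleftrightarrow> (\<forall>x\<in>set \<pi>. J < x) \<and> count_list \<pi> (Suc J) < u \<and> bressoud k ((k - 1) * J + u + 1) \<pi>"

definition gf :: "nat \<Rightarrow> nat \<Rightarrow> nat \<Rightarrow> complex fps" where
  "gf k u J = partition_gf (admissible k u J)"

text \<open>With \<open>u = k + 1 - i\<close> the number \<open>r + k\<close> has the same parity as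
  \<open>(k - 1) * J + u + 1\<close>. The latter form keeps \<open>u\<close> without subtraction and
  still makes sense at \<open>u = 0\<close>.\<close>

lemma gf_eq_restricted_partitions:
  assumes "k \<ge> 2" "1 \<le> i" "i \<le> k"
  shows "gf k (k + 1 - i) J = Abs_fps (\<lambda>n. of_nat (card (restricted_partitions k J i n)))"
proof -
  have "restricted_partitions k J i n = {\<pi>. is_partition n \<pi> \<and> admissible k (k + 1 - i) J \<pi>}" for n
  proof -
    have "\<pi> \<in> restricted_partitions k J i n \<longleftrightarrow> admissible k (k + 1 - i) J \<pi>" if part: "is_partition n \<pi>" for \<pi>
    proof -
      have s: "sorted_wrt (\<ge>) \<pi>" using part by (simp add: is_partition_def)
      have 1: "(\<pi> \<noteq> [] \<longrightarrow> J + 1 \<le> part \<pi> (length \<pi>)) \<longleftrightarrow> (\<forall>x\<in>set \<pi>. J < x)"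
      proof (cases \<pi> rule: rev_cases)
        case (snoc ys y)
        then show ?thesis using s by (auto simp: sorted_wrt_append)
      qed simp
      have 2: "count_list \<pi> (J + 1) \<le> k - i \<longleftrightarrow> count_list \<pi> (Suc J) < k + 1 - i" using assms by auto
      have 3: "bressoud k ((k - 1) * J + i + k) \<pi> = bressoud k ((k - 1) * J + (k + 1 - i) + 1) \<pi>"
      proof (rule bressoud_parity_cong)
        have "(k - 1) * J + i + k + ((k - 1) * J + (k + 1 - i) + 1) = 2 * ((k - 1) * J + k + 1)"
          using assms by simp
        then show "even ((k - 1) * J + i + k + ((k - 1) * J + (k + 1 - i) + 1))" by presburger
      qed
      show ?thesis
        unfolding restricted_partitions_def admissible_def
        using part 1 2 3 window_conditions_iff[OF s assms(1), of "(k - 1) * J + i + k"] by auto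
    qed
    then show ?thesis by (auto simp: restricted_partitions_def)
  qed
  then show ?thesis by (simp add: gf_def partition_gf_def)
qed

lemma gf_0 [simp]: "gf k 0 J = 0"
  by (simp add: gf_def partition_gf_def admissible_def fps_eq_iff)

section \<open>Removing the smallest parts\<close>

lemma sorted_split_smallest:
  assumes "sorted_wrt (\<ge>) \<pi>" "\<forall>x\<in>set \<pi>. J < x"
  shows "\<exists>\<sigma>. \<pi> = \<sigma> @ replicate (count_list \<pi> (Suc J)) (Suc J) \<and> (\<forall>x\<in>set \<sigma>. Suc J < x)"
  using assms
proof (induction \<pi>)
  case (Cons a \<pi>)
  then obtain \<sigma> where \<sigma>: "\<pi> = \<sigma> @ replicate (count_list \<pi> (Suc J)) (Suc J)" "\<forall>x\<in>set \<sigma>. Suc J < x" by auto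
  show ?case
  proof (cases "a = Suc J")
    case True
    have "\<sigma> = []"
    proof (rule ccontr)
      assume "\<sigma> \<noteq> []"
      then have "hd \<sigma> \<in> set \<sigma>" by simp
      moreover have "set \<sigma> \<subseteq> set \<pi>" using \<sigma>(1) by (metis set_append Un_upper1)
      ultimately show False using Cons.prems \<sigma>(2) True by fastforce
    qed
    then show ?thesis using \<sigma> True by (metis append_Nil count_list.simps(2) empty_iff list.set(1) replicate_Suc Suc_eq_plus1)
  next
    case False
    then have "Suc J < a" using Cons.prems by auto
    then show ?thesis using \<sigma> False by (intro exI[of _ "a # \<sigma>"]) auto
  qed
qed simp

text \<open>Let \<open>c\<close> count the parts \<open>J+2\<close>. When
  \<open>m + c = k - 1\<close>, the parity condition reduces to \<open>even (m + u + 1)\<close>. For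
  \<open>m = u - 1\<close> it holds, so the extreme value \<open>c = k - u\<close> is allowed; for
  \<open>m = u - 2\<close> it fails, so the extreme value \<open>c = k + 1 - u\<close> is excluded.
  Both cases thus mean \<open>c < k + 1 - u\<close>. The parity parameter of level
  \<open>Suc J\<close> agrees with the old one modulo 2.\<close>

lemma admissible_append:
  assumes "2 \<le> k" "1 \<le> u" "u \<le> k" and big: "\<forall>x\<in>set \<sigma>. Suc J < x"
    and m: "m + 1 = u \<or> m + 2 = u"
  shows "admissible k u J (\<sigma> @ replicate m (Suc J)) \<longleftrightarrow> admissible k (k + 1 - u) (Suc J) \<sigma>"
proof -
  define c where "c = count_list \<sigma> (Suc (Suc J))"
  define b where "b = (k - 1) * J + u + 1"
  have par: "bressoud k ((k - 1) * Suc J + (k + 1 - u) + 1) \<sigma> = bressoud k b \<sigma>"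
  proof (rule bressoud_parity_cong)
    have "(k - 1) * Suc J + (k + 1 - u) + 1 + b = 2 * ((k - 1) * J + k + 1)"
      using assms by (simp add: b_def)
    then show "even ((k - 1) * Suc J + (k + 1 - u) + 1 + b)" by presburger
  qed
  have z: "count_list \<sigma> (Suc J) = 0" using big by (auto simp: count_list_0_iff)
  have key: "(m + c \<le> k - 1 \<and> (m + c = k - 1 \<longrightarrow> even (Suc J * m + Suc (Suc J) * c + b))) \<longleftrightarrow> c < k + 1 - u"
  proof (cases "m + c = k - 1")
    case True
    have "Suc J * m + Suc (Suc J) * c + b = (k - 1) * Suc J + c + b"
      using True[symmetric] by (simp add: algebra_simps)
    also have "\<dots> = 2 * ((k - 1) * J) + (k - 1 + c + u + 1)" by (simp add: b_def)
    finally have eq: "Suc J * m + Suc (Suc J) * c + b = 2 * ((k - 1) * J) + (k - 1 + c + u + 1)" .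
    have "even (Suc J * m + Suc (Suc J) * c + b) \<longleftrightarrow> even (k - 1 + c + u + 1)"
      unfolding eq by (simp only: even_add even_mult_iff) simp
    also have "k - 1 + c + u + 1 = 2 * c + (m + u + 1)" using True by simp
    finally have "even (Suc J * m + Suc (Suc J) * c + b) \<longleftrightarrow> even (m + u + 1)" by simp
    moreover have "even (m + u + 1) \<longleftrightarrow> c < k + 1 - u"
      using m
    proof
      assume "m + 1 = u"
      moreover from this have "c < k + 1 - u" using True assms by linarith
      ultimately show ?thesis by auto
    next
      assume "m + 2 = u"
      moreover from this have "\<not> c < k + 1 - u" using True assms by linarith
      ultimately show ?thesis by auto
    qed
    ultimately show ?thesis using True by simp
  next
    case False
    have "m + c \<le> k - 1 \<longleftrightarrow> c < k + 1 - u" using False m assms by linarith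
    with False show ?thesis by simp
  qed
  have "admissible k u J (\<sigma> @ replicate m (Suc J)) \<longleftrightarrow>
     bressoud k b \<sigma> \<and> m + c \<le> k - 1 \<and> (m + c = k - 1 \<longrightarrow> even (Suc J * m + Suc (Suc J) * c + b))"
    using m big unfolding admissible_def bressoud_append[OF big] b_def[symmetric] c_def
    by (auto simp: count_list_replicate z)
  also have "\<dots> \<longleftrightarrow> admissible k (k + 1 - u) (Suc J) \<sigma>"
    unfolding admissible_def par key using big c_def by auto
  finally show ?thesis .
qed

lemma admissible_iff_append:
  assumes "2 \<le> k" "1 \<le> u" "u \<le> k" and m: "m + 1 = u \<or> m + 2 = u" and s: "sorted_wrt (\<ge>) \<pi>"
  shows "admissible k u J \<pi> \<and> count_list \<pi> (Suc J) = m \<longleftrightarrow>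
    (\<exists>\<sigma>. \<pi> = \<sigma> @ replicate m (Suc J) \<and> admissible k (k + 1 - u) (Suc J) \<sigma>)"
proof
  assume a: "admissible k u J \<pi> \<and> count_list \<pi> (Suc J) = m"
  then obtain \<sigma> where "\<pi> = \<sigma> @ replicate m (Suc J)" "\<forall>x\<in>set \<sigma>. Suc J < x"
    using sorted_split_smallest[OF s, of J] unfolding admissible_def by auto
  then show "\<exists>\<sigma>. \<pi> = \<sigma> @ replicate m (Suc J) \<and> admissible k (k + 1 - u) (Suc J) \<sigma>"
    using a admissible_append[OF assms(1-3) _ m] by blast
next
  assume "\<exists>\<sigma>. \<pi> = \<sigma> @ replicate m (Suc J) \<and> admissible k (k + 1 - u) (Suc J) \<sigma>"
  then obtain \<sigma> where \<sigma>: "\<pi> = \<sigma> @ replicate m (Suc J)" "admissible k (k + 1 - u) (Suc J) \<sigma>" by blast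
  then have big: "\<forall>x\<in>set \<sigma>. Suc J < x" by (simp add: admissible_def)
  then have "count_list \<sigma> (Suc J) = 0" by (auto simp: count_list_0_iff)
  then show "admissible k u J \<pi> \<and> count_list \<pi> (Suc J) = m"
    using \<sigma> big admissible_append[OF assms(1-3) big m] by (simp add: count_list_replicate)
qed

text \<open>For \<open>u = 1\<close> no part \<open>J+1\<close> may occur, so the case
  \<open>m = 0\<close> of the append lemma is already a bijection. This mirrors the index shared by
  consecutive blocks.\<close>

lemma gf_1:
  assumes "2 \<le> k"
  shows "gf k 1 J = gf k k (Suc J)"
  unfolding gf_def
proof (rule partition_gf_cong)
  fix n \<pi> assume "is_partition n \<pi>"
  then have s: "sorted_wrt (\<ge>) \<pi>" by (simp add: is_partition_def)
  show "admissible k 1 J \<pi> = admissible k k (Suc J) \<pi>"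
    using admissible_iff_append[OF assms, of 1 0 \<pi> J] assms s by (auto simp: admissible_def)
qed

lemma gf_rec:
  assumes k: "2 \<le> k" and u: "2 \<le> u" "u \<le> k"
  shows "gf k u J = gf k (u - 2) J + fps_X ^ (Suc J * (u - 2)) * (1 + fps_X ^ Suc J) * gf k (k + 1 - u) (Suc J)"
proof -
  let ?A = "\<lambda>m \<pi>. \<exists>\<sigma>. \<pi> = \<sigma> @ replicate m (Suc J) \<and> admissible k (k + 1 - u) (Suc J) \<sigma>"
  have A: "?A m \<pi> \<longleftrightarrow> admissible k u J \<pi> \<and> count_list \<pi> (Suc J) = m"
    if "is_partition n \<pi>" "m + 1 = u \<or> m + 2 = u" for m n \<pi>
    using admissible_iff_append[OF k _ u(2) that(2), of \<pi> J] that u by (simp add: is_partition_def)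
  have A1: "?A (u - 1) \<pi> \<longleftrightarrow> admissible k u J \<pi> \<and> count_list \<pi> (Suc J) = u - 1"
    and A2: "?A (u - 2) \<pi> \<longleftrightarrow> admissible k u J \<pi> \<and> count_list \<pi> (Suc J) = u - 2"
    if "is_partition n \<pi>" for n \<pi>
    by (rule A[OF that], use u in linarith)+
  \<comment> \<open>Lowering \<open>u\<close> by 2 keeps the parity condition, so the class for
    \<open>u - 2\<close> differs from that for \<open>u\<close> only in the bound on the number of
    parts \<open>J+1\<close>.\<close>
  have par: "bressoud k ((k - 1) * J + (u - 2) + 1) \<pi> = bressoud k ((k - 1) * J + u + 1) \<pi>" for \<pi>
    by (rule bressoud_parity_cong) (use u in auto)
  have split: "admissible k u J \<pi> \<longleftrightarrow> admissible k (u - 2) J \<pi> \<or> (?A (u - 1) \<pi> \<or> ?A (u - 2) \<pi>)"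
    if "is_partition n \<pi>" for n \<pi>
  proof -
    have "admissible k (u - 2) J \<pi> \<longleftrightarrow> admissible k u J \<pi> \<and> count_list \<pi> (Suc J) < u - 2"
      unfolding admissible_def par by auto
    moreover have "admissible k u J \<pi> \<Longrightarrow> count_list \<pi> (Suc J) < u" by (simp add: admissible_def)
    moreover have "c < u \<longleftrightarrow> c < u - 2 \<or> c = u - 1 \<or> c = u - 2" for c using u by linarith
    ultimately show ?thesis
      using A1[OF that] A2[OF that] by blast
  qed
  have shift: "partition_gf (?A m) = fps_X ^ (Suc J * m) * gf k (k + 1 - u) (Suc J)" for m
    unfolding gf_def by (rule partition_gf_append) (auto simp: admissible_def)
  have "gf k u J = partition_gf (\<lambda>\<pi>. admissible k (u - 2) J \<pi> \<or> (?A (u - 1) \<pi> \<or> ?A (u - 2) \<pi>))"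
    unfolding gf_def by (rule partition_gf_cong) (rule split)
  also have "\<dots> = gf k (u - 2) J + partition_gf (\<lambda>\<pi>. ?A (u - 1) \<pi> \<or> ?A (u - 2) \<pi>)"
    unfolding gf_def
  proof (rule partition_gf_disj)
    fix n \<pi> assume p: "is_partition n \<pi>"
    show "\<not> (admissible k (u - 2) J \<pi> \<and> (?A (u - 1) \<pi> \<or> ?A (u - 2) \<pi>))"
      using A1[OF p] A2[OF p] u by (auto simp: admissible_def[of k "u - 2"])
  qed
  also have "partition_gf (\<lambda>\<pi>. ?A (u - 1) \<pi> \<or> ?A (u - 2) \<pi>) = partition_gf (?A (u - 1)) + partition_gf (?A (u - 2))"
  proof (rule partition_gf_disj)
    fix n \<pi> assume p: "is_partition n \<pi>"
    show "\<not> (?A (u - 1) \<pi> \<and> ?A (u - 2) \<pi>)"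
    proof -
      have "u - 1 \<noteq> u - 2" using u by linarith
      then show ?thesis using A1[OF p] A2[OF p] by metis
    qed
  qed
  also have "\<dots> = fps_X ^ (Suc J * (u - 2)) * (1 + fps_X ^ Suc J) * gf k (k + 1 - u) (Suc J)"
  proof -
    have "u - 1 = Suc (u - 2)" using u by simp
    then have "fps_X ^ (Suc J * (u - 1)) = (fps_X ^ (Suc J * (u - 2)) * fps_X ^ Suc J :: complex fps)"
      by (simp add: power_add algebra_simps)
    then show ?thesis unfolding shift by (simp add: algebra_simps)
  qed
  finally show ?thesis .
qed

text \<open>A nonempty partition with all parts above \<open>J\<close> has size above
  \<open>J\<close>. This is the boundary value at a high level.\<close>

lemma gf_nth_low:
  assumes "2 \<le> k" "1 \<le> u" "n \<le> J"
  shows "gf k u J $ n = (if n = 0 then 1 else 0)"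
proof (cases "n = 0")
  case True
  have "{\<pi>. is_partition 0 \<pi> \<and> admissible k u J \<pi>} = {[]}"
  proof -
    have "\<pi> = []" if "is_partition 0 \<pi>" for \<pi> using that by (cases \<pi>) (auto simp: is_partition_def)
    moreover have "is_partition 0 []" by (simp add: is_partition_def)
    moreover have "admissible k u J []" using assms by (auto simp: admissible_def bressoud_def)
    ultimately show ?thesis by auto
  qed
  then show ?thesis using True by (simp add: gf_def partition_gf_def)
next
  case False
  have e: "{\<pi>. is_partition n \<pi> \<and> admissible k u J \<pi>} = {}"
  proof -
    have False if "is_partition n \<pi>" "admissible k u J \<pi>" for \<pi>
    proof (cases \<pi>)
      case Nil
      then show False using that False by (simp add: is_partition_def)
    next
      case (Cons a \<tau>)
      then show False using that assms by (auto simp: is_partition_def admissible_def)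
    qed
    then show ?thesis by blast
  qed
  show ?thesis using False unfolding gf_def partition_gf_def fps_nth_Abs_fps e by simp
qed

section \<open>Identification with the series \<open>B\<close>\<close>

lemma cong_X_one_minus_power: "M \<le> e \<Longrightarrow> cong_X M (1 - fps_X ^ e) (1 :: 'a::comm_ring_1 fps)"
  using cong_X_diff[OF cong_X_refl[of M 1] cong_X_mult_power_0[of M e 1]] by simp

lemma cong_X_qpoch:
  assumes "d \<le> m"
  shows "cong_X (e * (d + 1)) (qpoch (fps_X ^ e) m) (qpoch (fps_X ^ e) d :: 'a::comm_ring_1 fps)"
  using assms
proof (induction m rule: dec_induct)
  case (step m)
  have "cong_X (e * (d + 1)) (1 - (fps_X ^ e) ^ Suc m) (1 :: 'a fps)"
    unfolding power_mult[symmetric] using step by (intro cong_X_one_minus_power mult_le_mono) auto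
  from cong_X_mult[OF step.IH this] show ?case by (simp only: qpoch_Suc mult_1_right)
qed simp

lemma qpoch_nth_0:
  assumes "e > 0"
  shows "qpoch (fps_X ^ e :: 'a::comm_ring_1 fps) m $ 0 = 1"
proof (induction m)
  case (Suc m)
  have "((fps_X :: 'a fps) ^ (e * Suc m)) $ 0 = 0" using assms unfolding fps_X_power_nth by simp
  then have "(1 - (fps_X ^ e) ^ Suc m :: 'a fps) $ 0 = 1" unfolding power_mult[symmetric] by simp
  with Suc show ?case by (simp only: qpoch_Suc fps_mult_nth_0 mult_1_right)
qed simp

text \<open>A finite substitute for the limit of a q-binomial, the reciprocal of the infinite
  q-Pochhammer symbol. To the given precision the symbols of indices \<open>N\<close>,
  \<open>a\<close>, \<open>b\<close> and \<open>a + b\<close> all agree with that of index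
  \<open>d\<close>, which is a unit and cancels.\<close>

lemma cong_X_gauss_binomial:
  assumes "e > 0" "d \<le> a" "d \<le> b" "d \<le> N"
  shows "cong_X (e * (d + 1)) (qpoch (fps_X ^ e) N * gauss_binomial (fps_X ^ e) (a + b) a) (1 :: 'a::field fps)"
proof -
  let ?p = "fps_X ^ e :: 'a fps"
  let ?g = "gauss_binomial ?p (a + b) a" and ?M = "e * (d + 1)"
  define c where "c = qpoch ?p d"
  have Q: "cong_X ?M (qpoch ?p m) c" if "d \<le> m" for m
    unfolding c_def using that by (rule cong_X_qpoch)
  have "cong_X ?M (qpoch ?p N * ?g * (c * c)) (qpoch ?p N * ?g * (qpoch ?p a * qpoch ?p b))"
    using assms by (intro cong_X_mult cong_X_refl cong_X_sym[OF Q])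
  also have "qpoch ?p N * ?g * (qpoch ?p a * qpoch ?p b) = qpoch ?p N * qpoch ?p (a + b)"
    by (simp only: mult.assoc gauss_binomial_qpoch)
  also have "cong_X ?M \<dots> (c * c)"
    using assms by (intro cong_X_mult Q) auto
  finally have "cong_X ?M ((c * c) * (qpoch ?p N * ?g)) ((c * c) * 1)"
    by (simp only: mult_1_left mult_1_right mult.commute)
  moreover have "(c * c) $ 0 \<noteq> 0" using assms by (simp add: c_def qpoch_nth_0)
  ultimately show ?thesis by (rule cong_X_cancel[rotated])
qed

text \<open>At level 0 the q-binomials are 1 and each term is a difference of two monomials. The
  first belongs to the theta term \<open>n\<close> with exponent \<open>k + a\<close>, the second to
  the theta term \<open>Suc n\<close> with \<open>k - a\<close>. The regrouping lacks only
  \<open>V N\<close>, which is divisible by \<open>X^N\<close>.\<close>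

lemma closed_sum_eq_theta:
  assumes "2 \<le> k" "a < k"
  shows "cong_X N (closed_sum k N (k - a) 0)
    (1 + (\<Sum>n=1..N. (-1) ^ n * (fps_X ^ (2 * k)) ^ (n choose 2) * ((fps_X ^ (k - a)) ^ n + (fps_X ^ (k + a)) ^ n)))"
proof -
  let ?X = "fps_X :: complex fps"
  define U where "U n = (-1) ^ n * (?X ^ (2 * k)) ^ (n choose 2) * (?X ^ (k - a)) ^ n" for n
  define V where "V n = (-1) ^ n * (?X ^ (2 * k)) ^ (n choose 2) * (?X ^ (k + a)) ^ n" for n
  have c2: "2 * (n choose 2) + n = n * n" for n :: nat
    by (induction n) (auto simp: numeral_2_eq_2)
  have V: "V n = (-1) ^ n * ?X ^ (k * n * n + a * n)" for n
  proof -
    have "2 * k * (n choose 2) + (k + a) * n = k * (2 * (n choose 2) + n) + a * n" by (simp add: algebra_simps)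
    also have "\<dots> = k * n * n + a * n" by (simp add: c2)
    finally show ?thesis unfolding V_def mult.assoc[of "(-1) ^ n"] power_mult[symmetric] power_add[symmetric]
        by (rule arg_cong)
  qed
  have U: "U (Suc n) = - ((-1) ^ n * ?X ^ (k * n * (n + 1) + (1 + n) * (k - a)))" for n
  proof -
    have "Suc n choose 2 = n + (n choose 2)" by (simp add: numeral_2_eq_2)
    then have "2 * k * (Suc n choose 2) + (k - a) * Suc n = k * (2 * (n choose 2) + n) + k * n + (1 + n) * (k - a)"
      by (simp add: algebra_simps)
    also have "\<dots> = k * n * (n + 1) + (1 + n) * (k - a)" unfolding c2 by (simp add: algebra_simps)
    finally show ?thesis unfolding U_def mult.assoc[of "(-1) ^ Suc n"] power_mult[symmetric] power_add[symmetric] by simp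
  qed
  have "closed_term k (k - a) 0 n = V n + U (Suc n)" for n
  proof -
    have "k - (k - a) = a" using assms by simp
    then show ?thesis unfolding closed_term_def V U by (simp add: algebra_simps)
  qed
  then have "closed_sum k N (k - a) 0 = (\<Sum>n<N. V n) + (\<Sum>n<N. U (Suc n))"
    by (simp add: closed_sum_def sum.distrib)
  also have "(\<Sum>n<N. U (Suc n)) = (\<Sum>n=1..N. U n)"
    by (rule sum.reindex_bij_witness[of _ "\<lambda>n. n - 1" Suc]) auto
  finally have eq: "closed_sum k N (k - a) 0 = (\<Sum>n<N. V n) + (\<Sum>n=1..N. U n)" .
  have "N = 0 \<or> 1 \<le> k * N" using assms by auto
  then have "N \<le> k * N * N" by auto
  then have "N \<le> k * N * N + a * N" by linarith
  from cong_X_mult_power_0[OF this, of "(-1) ^ N"] have "cong_X N (V N) 0" by (simp only: V mult.commute)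
  then have "cong_X N (\<Sum>n<N. V n) ((\<Sum>n<N. V n) + V N)"
    using cong_X_sym[OF cong_X_add[OF cong_X_refl[of N "\<Sum>n<N. V n"]]] by fastforce
  also have "(\<Sum>n<N. V n) + V N = (\<Sum>n\<le>N. V n)" by (simp add: lessThan_Suc_atMost[symmetric])
  also have "\<dots> = V 0 + (\<Sum>n=1..N. V n)" by (simp add: sum.atMost_shift sum.atLeast1_atMost_eq)
  also have "V 0 = 1" by (simp add: V)
  finally have "cong_X N (closed_sum k N (k - a) 0) (1 + (\<Sum>n=1..N. V n) + (\<Sum>n=1..N. U n))"
    unfolding eq by (rule cong_X_add) simp
  also have "1 + (\<Sum>n=1..N. V n) + (\<Sum>n=1..N. U n) = 1 + (\<Sum>n=1..N. U n + V n)"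
    by (simp add: sum.distrib)
  finally show ?thesis by (simp add: U_def V_def distrib_left)
qed

text \<open>The finite triple product is used with \<open>p = X^(2k)\<close>,
  \<open>u = X^(k-a)\<close> and \<open>v = X^(k+a)\<close>; the remaining factors form
  \<open>qpoch p N\<close>, which neutralises each q-binomial.\<close>

lemma cong_X_theta_product:
  assumes "2 \<le> k" "a < k"
  shows "cong_X N (\<Prod>m<N. (1 - fps_X ^ (2 * k * Suc m)) * (1 - fps_X ^ (2 * k * m + k + a)) * (1 - fps_X ^ (2 * k * m + k - a)))
    (closed_sum k N (k - a) 0)"
proof -
  let ?X = "fps_X :: complex fps"
  let ?p = "?X ^ (2 * k)" and ?u = "?X ^ (k - a)" and ?v = "?X ^ (k + a)"
  let ?g = "gauss_binomial ?p (2 * N)" and ?P = "qpoch ?p N"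
  have puv: "?p = ?u * ?v" using assms by (simp flip: power_add)
  have u: "?X ^ (2 * k * m + k - a) = ?u * ?p ^ m" and v: "?X ^ (2 * k * m + k + a) = ?v * ?p ^ m" for m
    using assms by (simp_all add: algebra_simps flip: power_mult power_add)
  have prod: "(\<Prod>m<N. (1 - ?X ^ (2 * k * Suc m)) * (1 - ?X ^ (2 * k * m + k + a)) * (1 - ?X ^ (2 * k * m + k - a))) =
     ?P * (\<Prod>m<N. (1 - ?u * ?p ^ m) * (1 - ?v * ?p ^ m))"
  proof -
    have "?P = (\<Prod>m<N. 1 - ?X ^ (2 * k * Suc m))"
      unfolding qpoch_def power_mult[symmetric]
      by (rule prod.reindex_bij_witness[of _ Suc "\<lambda>m. m - 1"]) auto
    then show ?thesis unfolding u v by (simp only: prod.distrib mult_ac)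
  qed
  have g0: "cong_X N (?P * ?g N) 1"
  proof -
    have "1 * N \<le> 2 * k * (N + 1)" using assms by (intro mult_le_mono) auto
    then have "N \<le> 2 * k * (N + 1)" by simp
    from cong_X_mono[OF cong_X_gauss_binomial[of "2 * k" N N N N] this] show ?thesis
      using assms by (simp add: mult_2)
  qed
  \<comment> \<open>The q-binomials far from the centre are known only modulo
    \<open>p^(N-n+1)\<close>; the factor \<open>p ^ (n choose 2)\<close> in front makes up for the
    loss since \<open>n \<le> (n choose 2) + 1\<close>.\<close>
  have le: "N \<le> (2 * k) * (n choose 2) + 2 * k * (N - n + 1)" if "n \<le> N" for n
  proof -
    have "n \<le> (n choose 2) + 1" by (induction n) (auto simp: numeral_2_eq_2)
    then have "N \<le> (n choose 2) + (N - n + 1)" using that by linarith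
    also have "1 * ((n choose 2) + (N - n + 1)) \<le> 2 * k * ((n choose 2) + (N - n + 1))"
      using assms by (intro mult_le_mono) auto
    then have "(n choose 2) + (N - n + 1) \<le> 2 * k * ((n choose 2) + (N - n + 1))" by (simp only: mult_1_left)
    finally show ?thesis by (simp only: distrib_left)
  qed
  have summand: "cong_X N ((-1) ^ n * ?p ^ (n choose 2) * (w * (?P * ?g j))) ((-1) ^ n * ?p ^ (n choose 2) * w)"
    if n: "n \<le> N" and j: "j = N - n \<or> j = N + n" for n j w
  proof -
    have "cong_X (2 * k * (N - n + 1)) (?P * ?g j) 1"
      using j cong_X_gauss_binomial[of "2 * k" "N - n" "N - n" "N + n" N, where 'a = complex]
        cong_X_gauss_binomial[of "2 * k" "N - n" "N + n" "N - n" N, where 'a = complex] n assms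
      by (auto simp: mult_2)
    then have "cong_X ((2 * k) * (n choose 2) + 2 * k * (N - n + 1)) (?X ^ ((2 * k) * (n choose 2)) * (?P * ?g j)) (?X ^ ((2 * k) * (n choose 2)) * 1)"
      by (rule cong_X_power_mult)
    from cong_X_mono[OF this le[OF n]] have "cong_X N (?p ^ (n choose 2) * (?P * ?g j)) (?p ^ (n choose 2) * 1)"
      by (simp only: power_mult)
    from cong_X_mult[OF cong_X_refl[of N "(-1) ^ n * w"] this] show ?thesis by (simp only: mult_ac mult_1_left mult_1_right)
  qed
  have "cong_X N (?P * (\<Prod>m<N. (1 - ?u * ?p ^ m) * (1 - ?v * ?p ^ m)))
     (1 + (\<Sum>n=1..N. (-1) ^ n * ?p ^ (n choose 2) * (?u ^ n + ?v ^ n)))"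
  proof -
    have "?P * (\<Prod>m<N. (1 - ?u * ?p ^ m) * (1 - ?v * ?p ^ m)) =
      ?P * ?g N + (\<Sum>n=1..N. (-1) ^ n * ?p ^ (n choose 2) * (?u ^ n * (?P * ?g (N - n)))
         + (-1) ^ n * ?p ^ (n choose 2) * (?v ^ n * (?P * ?g (N + n))))"
      by (subst finite_jacobi_triple_product[OF puv])
         (auto simp: distrib_left sum_distrib_left algebra_simps)
    moreover have "cong_X N \<dots> (1 + (\<Sum>n=1..N. (-1) ^ n * ?p ^ (n choose 2) * ?u ^ n + (-1) ^ n * ?p ^ (n choose 2) * ?v ^ n))"
      by (intro cong_X_add g0 cong_X_sum summand) auto
    ultimately show ?thesis by (simp only: distrib_left)
  qed
  also have "cong_X N \<dots> (closed_sum k N (k - a) 0)"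
    by (rule cong_X_sym[OF closed_sum_eq_theta[OF assms]])
  finally show ?thesis unfolding prod .
qed

section \<open>Agreement of the generating functions with the closed form\<close>

lemma closed_sum_low:
  assumes "2 \<le> k" "1 \<le> u" "1 \<le> N"
  shows "cong_X L (closed_sum k N u L) 1"
proof -
  \<comment> \<open>Term 0 is \<open>1 - X^((L+1)*u)\<close>, and both monomials of a later term
    contain \<open>X^(L*(k-1)*n)\<close>.\<close>
  have t: "cong_X L (closed_term k u L n) (if n = 0 then 1 else 0)" for n
  proof (cases "n = 0")
    case True
    have "L \<le> (L + 1) * u" using assms by (cases u) auto
    then have "cong_X L (1 - fps_X ^ ((L + 1) * u)) (1 :: complex fps)" by (rule cong_X_one_minus_power)
    then show ?thesis using True by (simp add: closed_term_def)
  next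
    case False
    have "L * 1 * 1 \<le> L * (k - 1) * n" using assms False by (intro mult_le_mono) auto
    then have "L \<le> L * (k - 1) * n" by simp
    then have "L \<le> L * (k - 1) * n + k * n * n + (k - u) * n"
      "L \<le> L * (k - 1) * n + k * n * (n + 1) + (L + 1 + n) * u" by linarith+
    from cong_X_diff[OF this[THEN cong_X_mult_power_0[where f = 1]]]
    have "cong_X L (fps_X ^ (L * (k - 1) * n + k * n * n + (k - u) * n)
      - fps_X ^ (L * (k - 1) * n + k * n * (n + 1) + (L + 1 + n) * u)) (0 :: complex fps)" by simp
    from cong_X_mult[OF cong_X_refl this] show ?thesis using False by (simp add: closed_term_def)
  qed
  have "cong_X L (\<Sum>n<N. closed_term k u L n) (\<Sum>n<N. if n = 0 then 1 else 0)"
    by (intro cong_X_sum t)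
  then show ?thesis using assms by (simp add: closed_sum_def)
qed

text \<open>The recursion determines the family at level \<open>j\<close> from the family at level \<open>Suc j\<close>, without
  negative powers, and for \<open>u \<ge> 1\<close> both families are \<open>1\<close> modulo \<open>q ^ L\<close> at level \<open>L\<close>.\<close>

lemma gf_cong_closed_sum:
  assumes k: "2 \<le> k" and M: "1 \<le> M" "M \<le> N" "M \<le> L" and "j \<le> L" "u \<le> k"
  shows "cong_X M ((\<Prod>m\<in>{j<..L}. 1 - fps_X ^ m) * gf k u j) (closed_sum k N u j)"
  using \<open>j \<le> L\<close> \<open>u \<le> k\<close>
proof (induction j arbitrary: u rule: inc_induct)
  case base
  show ?case
  proof (cases "u = 0")
    case False
    have "cong_X L (gf k u L) 1"
      using gf_nth_low[OF k, of u _ L] False by (auto simp: cong_X_iff_nth)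
    also have "cong_X L 1 (closed_sum k N u L)"
      by (rule cong_X_sym, rule closed_sum_low) (use k False M in auto)
    finally show ?thesis using M by (auto intro: cong_X_mono)
  qed simp
next
  case (step j)
  let ?E = "\<lambda>j. (\<Prod>m\<in>{j<..L}. 1 - fps_X ^ m) :: complex fps"
  let ?Q = "fps_X ^ Suc j :: complex fps"
  have E: "?E j = (1 - ?Q) * ?E (Suc j)"
  proof -
    have "{j<..L} = insert (Suc j) {Suc j<..L}" using step.hyps by auto
    then show ?thesis by simp
  qed
  \<comment> \<open>Descending one level adds the factor \<open>1 - Q\<close> to the product; with
    the \<open>1 + Q\<close> of the partition recursion it yields the coefficient in the recursion
    of the closed form.\<close>
  have Q: "(1 + ?Q) * (1 - ?Q) = 1 - (fps_X ^ 2) ^ Suc j"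
  proof -
    have "(1 + x) * (1 - x) = 1 - x ^ 2" for x :: "complex fps"
      by (simp add: power2_eq_square algebra_simps)
    then show ?thesis by (simp only: power_mult[symmetric] mult.commute)
  qed
  \<comment> \<open>Within one level the recursion lowers \<open>u\<close> by 2, so an inner
    induction on \<open>u\<close> runs down to 0 or 1.\<close>
  show ?case
    using step.prems
  proof (induction u rule: less_induct)
    case (less u)
    consider "u = 0" | "u = 1" | "2 \<le> u" by linarith
    then show ?case
    proof cases
      case 1
      then show ?thesis by simp
    next
      case 2
      obtain e R where e: "N \<le> e" "(1 + ?Q) * closed_sum k N 1 j =
          (1 - (fps_X ^ 2) ^ Suc j) * closed_sum k N k (Suc j) - fps_X ^ e * R"
        using closed_sum_1[OF k, of N j] by blast
      have "(1 + ?Q) * (?E j * gf k 1 j) = ((1 + ?Q) * (1 - ?Q)) * (?E (Suc j) * gf k k (Suc j)) - 0"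
        unfolding E gf_1[OF k] by (simp only: mult_ac diff_zero)
      moreover have "cong_X M \<dots> ((1 + ?Q) * closed_sum k N 1 j)"
        unfolding e(2) Q using e(1) M
        by (intro cong_X_diff cong_X_mult cong_X_refl step.IH cong_X_sym[OF cong_X_mult_power_0]) auto
      ultimately have "cong_X M ((1 + ?Q) * (?E j * gf k 1 j)) ((1 + ?Q) * closed_sum k N 1 j)" by (simp only:)
      \<comment> \<open>The recursion for the closed form at \<open>u = 1\<close> carries
        \<open>1 + Q\<close> on the left; being a unit, it is removed without loss of
        precision.\<close>
      moreover have "(1 + ?Q) $ 0 \<noteq> 0" by simp
      ultimately show ?thesis unfolding 2 by (rule cong_X_cancel[rotated])
    next
      case 3
      obtain e R where e: "N \<le> e" "closed_sum k N u j = closed_sum k N (u - 2) j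
         + fps_X ^ (Suc j * (u - 2)) * (1 - (fps_X ^ 2) ^ Suc j) * closed_sum k N (k + 1 - u) (Suc j) - fps_X ^ e * R"
        using closed_sum_rec[OF k 3 less.prems, of N j] by blast
      have "?E j * gf k u j = ?E j * gf k (u - 2) j
         + fps_X ^ (Suc j * (u - 2)) * ((1 + ?Q) * (1 - ?Q)) * (?E (Suc j) * gf k (k + 1 - u) (Suc j)) - 0"
        unfolding gf_rec[OF k 3 less.prems] distrib_left[of "?E j"] unfolding E by (simp only: mult_ac diff_zero)
      moreover have "cong_X M \<dots> (closed_sum k N u j)"
        unfolding e(2) Q using e(1) M 3 less.prems
        by (intro cong_X_diff cong_X_add cong_X_mult cong_X_refl step.IH less.IH cong_X_sym[OF cong_X_mult_power_0]) auto
      ultimately show ?thesis by (simp only:)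
    qed
  qed
qed

section \<open>The initial block and the passage to all blocks\<close>

lemma B_init_eq_gf:
  assumes k: "2 \<le> k" and i: "1 \<le> i" "i \<le> k"
  shows "B_init k i = fps_to_fls (gf k (k + 1 - i) 0)"
proof -
  \<comment> \<open>With this shift the two outer exponents become symmetric,
    \<open>2 * k * m' + k + a\<close> and \<open>2 * k * m' + k - a\<close>.\<close>
  define a where "a = i - 1"
  have a: "a < k" "k + 1 - i = k - a" using i by (auto simp: a_def)
  let ?X = "fps_X :: complex fps"
  define f where "f m = (1 - ?X ^ (2 * k * Suc m)) * (1 - ?X ^ (2 * k * m + k + a)) * (1 - ?X ^ (2 * k * m + k - a))" for m
  define g where "g m = 1 - ?X ^ Suc m" for m
  have f1: "cong_X (Suc m) (f m) 1" for m
  proof -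
    have "m \<le> k * m" using k by simp
    then have "Suc m \<le> 2 * k * Suc m" "Suc m \<le> 2 * k * m + k + a" "Suc m \<le> 2 * k * m + k - a"
      using a k by (simp_all, linarith+)
    from this[THEN cong_X_one_minus_power[where 'a = complex]] have "cong_X (Suc m) (f m) (1 * 1 * 1)"
      unfolding f_def by (intro cong_X_mult)
    then show ?thesis by simp
  qed
  have g1: "cong_X (Suc m) (g m) 1" for m
    unfolding g_def by (rule cong_X_one_minus_power) simp
  have num: "(\<Prod>m'. let m = Suc m' in
        (1 - q ^ (2 * k * m)) * (1 - q ^ (2 * k * m - k + i - 1)) * (1 - q ^ (2 * k * m - k - i + 1)))
     = fps_to_fls (fps_prodinf f)"
  proof -
    have "(let m = Suc m' in (1 - q ^ (2 * k * m)) * (1 - q ^ (2 * k * m - k + i - 1)) * (1 - q ^ (2 * k * m - k - i + 1)))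
      = fps_to_fls (f m')" for m'
    proof -
      have "2 * k * Suc m' - k + i - 1 = 2 * k * m' + k + a" "2 * k * Suc m' - k - i + 1 = 2 * k * m' + k - a"
        using i by (auto simp: a_def)
      then show ?thesis unfolding Let_def f_def
        by (simp only: fls_times_fps_to_fls fps_to_fls_minus fps_one_to_fls fps_to_fls_power fps_X_to_fls)
    qed
    then show ?thesis using prodinf_fps_to_fls(1)[OF f1] by simp
  qed
  have den: "qpoch_inf = fps_to_fls (fps_prodinf g)"
    unfolding qpoch_inf_def prodinf_fps_to_fls(1)[OF g1, symmetric] g_def
    by (simp only: fps_to_fls_minus fps_one_to_fls fps_to_fls_power fps_X_to_fls)
  have "fps_prodinf g * gf k (k - a) 0 = fps_prodinf f"
  proof (rule fps_ext)
    fix n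
    \<comment> \<open>One number serves as modulus, as truncation of the sum and the products, and
      as the level at which the descent starts; it exceeds \<open>n\<close>, so coefficient
      \<open>n\<close> is determined.\<close>
    define N where "N = Suc n"
    have "cong_X N (fps_prodinf g * gf k (k - a) 0) ((\<Prod>m<N. g m) * gf k (k - a) 0)"
      by (intro cong_X_mult cong_X_refl cong_X_sym[OF cong_X_prodinf[OF g1]]) auto
    also have "(\<Prod>m<N. g m) = (\<Prod>m\<in>{0<..N}. 1 - ?X ^ m)"
      unfolding g_def by (rule prod.reindex_bij_witness[of _ "\<lambda>m. m - 1" Suc]) auto
    also have "cong_X N (\<dots> * gf k (k - a) 0) (closed_sum k N (k - a) 0)"
      by (rule gf_cong_closed_sum) (use k in \<open>auto simp: N_def\<close>)
    also have "cong_X N \<dots> (\<Prod>m<N. f m)"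
      unfolding f_def by (rule cong_X_sym[OF cong_X_theta_product]) (use k a in auto)
    also have "cong_X N \<dots> (fps_prodinf f)"
      by (rule cong_X_prodinf[OF f1]) simp
    finally show "(fps_prodinf g * gf k (k - a) 0) $ n = fps_prodinf f $ n"
      by (simp add: cong_X_iff_nth N_def)
  qed
  then have "fps_to_fls (fps_prodinf f) = fps_to_fls (fps_prodinf g) * fps_to_fls (gf k (k - a) 0)"
    by (simp flip: fls_times_fps_to_fls)
  moreover have "fps_to_fls (fps_prodinf g) \<noteq> 0" using prodinf_fps_to_fls(2)[OF g1] by simp
  ultimately show ?thesis
    unfolding B_init_def num den a(2) by simp
qed

text \<open>Under \<open>u = k + 1 - i\<close> the series entering the definition of block
  \<open>Suc j\<close> at \<open>i \<ge> 3\<close> are those with parameters \<open>i\<close> and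
  \<open>i - 2\<close> at level \<open>j\<close>. Subtracting the weighted mean leaves
  \<open>Q / (1 + Q)\<close> times their difference, and the partition recursion turns this into
  \<open>Q^(i-1)\<close> times the series with parameter \<open>k + 1 - i\<close> at level
  \<open>Suc j\<close>.\<close>

lemma B_block_eq_gf:
  assumes k: "2 \<le> k"
  shows "1 \<le> i \<Longrightarrow> i \<le> k \<Longrightarrow> B_block k j i = fps_to_fls (gf k (k + 1 - i) j)"
proof (induction j arbitrary: i)
  case 0
  then show ?case using B_init_eq_gf[OF k] by simp
next
  case (Suc j)
  let ?Q = "q ^ (j + 1)"
  let ?g = "\<lambda>u j. fps_to_fls (gf k u j)"
  have Q0: "?Q \<noteq> 0" by simp
  have Q1: "1 + ?Q \<noteq> 0"
  proof -
    have "(1 + fps_X ^ (j + 1) :: complex fps) $ 0 = 1" by simp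
    then have "(1 + fps_X ^ (j + 1) :: complex fps) \<noteq> 0" by (metis fps_zero_nth zero_neq_one)
    moreover have "1 + ?Q = fps_to_fls (1 + fps_X ^ (j + 1))"
      by (simp only: fps_to_fls_plus fps_one_to_fls fps_to_fls_power fps_X_to_fls)
    ultimately show ?thesis by (simp only: fps_to_fls_eq_0_iff) simp
  qed
  have cancel2: "((1 + x) * y - (1 + x) * y / (1 + x)) / x = y" if "x \<noteq> 0" "1 + x \<noteq> 0" for x y :: "complex fls"
  proof -
    have "(1 + x) * y / (1 + x) = y" using that by simp
    then have "(1 + x) * y - (1 + x) * y / (1 + x) = x * y" by (simp add: distrib_right)
    then show ?thesis using that by simp
  qed
  have ghost_diff: "y - (y + x * z) / (1 + x) = x * (y - z) / (1 + x)" if "1 + x \<noteq> 0" for x y z :: "complex fls"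
    using that by (simp add: field_simps)
  have cancel3: "x * (w * (1 + x) * y) / (1 + x) / (x * w) = y"
      if "x \<noteq> 0" "1 + x \<noteq> 0" "w \<noteq> 0" for x y w :: "complex fls"
    using that by simp
  have rec: "?g u j = ?g (u - 2) j + ?Q ^ (u - 2) * (1 + ?Q) * ?g (k + 1 - u) (Suc j)" if "2 \<le> u" "u \<le> k" for u
  proof -
    have "?g u j = fps_to_fls (gf k (u - 2) j + fps_X ^ (Suc j * (u - 2)) * (1 + fps_X ^ Suc j) * gf k (k + 1 - u) (Suc j))"
      by (simp only: gf_rec[OF k that])
    then show ?thesis
      by (simp only: fls_times_fps_to_fls fps_to_fls_plus fps_one_to_fls fps_to_fls_power fps_X_to_fls power_mult Suc_eq_plus1)
  qed
  consider "i = 1" | "i = 2" | "3 \<le> i" using Suc.prems by linarith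
  then show ?case
  proof cases
    case 1
    then show ?thesis using Suc.IH[of k] k gf_1[OF k, of j] by simp
  next
    case 2
    \<comment> \<open>The last ghost series has only one summand, in accordance with the vanishing
      series at \<open>u - 2 = 0\<close>.\<close>
    have "B_block k j (k - 1) = ?g 2 j" using Suc.IH[of "k - 1"] k by simp
    also have "\<dots> = (1 + ?Q) * ?g (k - 1) (Suc j)" using rec[of 2] Suc.prems 2 by simp
    finally have b: "B_block k j (k - 1) = (1 + ?Q) * ?g (k - 1) (Suc j)" .
    have "B_block k (Suc j) i = (B_block k j (k - 1) - B_block k j (k - 1) / (1 + ?Q)) / ?Q"
      using 2 by (simp add: ghost_def Let_def)
    also have "\<dots> = ?g (k - 1) (Suc j)" unfolding b using Q0 Q1 by (rule cancel2)
    finally show ?thesis using 2 by simp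
  next
    case 3
    have b1: "B_block k j (k - i + 1) = ?g i j" using Suc.IH[of "k - i + 1"] 3 Suc.prems by simp
    have "k + 1 - (k - i + 3) = i - 2" using 3 Suc.prems by linarith
    then have b3: "B_block k j (k - i + 3) = ?g (i - 2) j" using Suc.IH[of "k - i + 3"] 3 Suc.prems by simp
    \<comment> \<open>Because \<open>i \<ge> 3\<close>, the ghost index stays below \<open>k\<close>
      and its right neighbour is still inside the block.\<close>
    have idx: "k - i + 2 \<noteq> k" "k - i + 2 - 1 = k - i + 1" "k - i + 2 + 1 = k - i + 3" using 3 Suc.prems by auto
    have "i - 1 = Suc (i - 2)" using 3 by linarith
    then have pw: "?Q ^ (i - 1) = ?Q * ?Q ^ (i - 2)" by (simp only: power_Suc)
    have "B_block k (Suc j) i = (?g i j - (?g i j + ?Q * ?g (i - 2) j) / (1 + ?Q)) / q ^ ((j + 1) * (i - 1))"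
      using 3 by (simp only: B_block.simps Let_def ghost_def idx b1 b3) simp
    also have "?g i j - (?g i j + ?Q * ?g (i - 2) j) / (1 + ?Q) = ?Q * (?g i j - ?g (i - 2) j) / (1 + ?Q)"
      using Q1 by (rule ghost_diff)
    also have "?g i j - ?g (i - 2) j = ?Q ^ (i - 2) * (1 + ?Q) * ?g (k + 1 - i) (Suc j)"
      using rec[of i] 3 Suc.prems by simp
    also have "?Q * (?Q ^ (i - 2) * (1 + ?Q) * ?g (k + 1 - i) (Suc j)) / (1 + ?Q) / q ^ ((j + 1) * (i - 1))
        = ?g (k + 1 - i) (Suc j)"
      unfolding power_mult pw using Q0 Q1 by (intro cancel3) auto
    finally show ?thesis .
  qed
qed

theorem theorem7p2:
  fixes k J i r :: nat
  assumes "k \<ge> 2" and "1 \<le> i" and "i \<le> k" and "r = (k - 1) * J + i"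
  shows "B k r = fps_to_fls (Abs_fps (\<lambda>n. of_nat (card (restricted_partitions k J i n))))"
  using B_eq_block[OF assms(1-3)] B_block_eq_gf[OF assms(1-3)] gf_eq_restricted_partitions[OF assms(1-3)] assms(4)
  by simp

end
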